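(* Let $b>0$ and let $\gamma$ be the doubly infinite vertical comb with teeth the segments $[in,in+b]$, $n\in\mathbb{Z}$. For any $p\in[1,2]$, with $p^{-1}+p'^{-1}=1$, the operator $\mathcal{L}_\gamma$ (the Laplace transform restricted to $\gamma$) acts continuously from $L^p(\mathbb{R}_+)$ to $L^{p'}(\gamma)$. That is, the inequality $$\left(\sum_{n=-\infty}^\infty\int_0^b|\mathcal{L}f(x+in)|^{p'}\,dx\right)^{1/p'}\le K_{12}(b,p)\,\|f\|_{L^p(\mathbb{R}_+)}$$ holds for all $f\in L^p(\mathbb{R}_+)$ with a constant $K_{12}(b,p)$ independent of $f$.
   Context: $\mathbb{R}_+=(0,\infty)$; $\mathcal{L}f(z)=\int_0^\infty f(t)e^{-zt}\,dt$ for $\mathrm{Re}\,z>0$. $L^{p'}(\gamma)$ is taken with respect to total arclength measure on the teeth. For $p=1$ ($p'=\infty$) the left-hand side is understood as the (essential) supremum of $|\mathcal{L}f|$ over the teeth. *)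

theory Defs
  imports "HOL-Probability.Essential_Supremum"
begin

text \<open>Real powers of extended nonnegative reals, for a positive exponent.\<close>

definition epowr :: "ennreal \<Rightarrow> real \<Rightarrow> ennreal" where
  "epowr x r = (if x = top then top else ennreal (enn2real x powr r))"

text \<open>The exponent ranges over \<open>[1, \<infinity>]\<close>.\<close>

definition Lp_norm :: "ennreal \<Rightarrow> 'a measure \<Rightarrow> ('a \<Rightarrow> 'b::real_normed_vector) \<Rightarrow> ennreal" where
  "Lp_norm p M f =
     (if p = top then esssup M (\<lambda>x. ennreal (norm (f x)))
      else epowr (\<integral>\<^sup>+x. ennreal (norm (f x) powr enn2real p) \<partial>M) (1 / enn2real p))"

text \<open>Functions, not equivalence classes modulo null sets.\<close>

definition Lp_space :: "ennreal \<Rightarrow> 'a measure \<Rightarrow> ('a \<Rightarrow> 'b::real_normed_vector) set" where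
  "Lp_space p M = {f \<in> borel_measurable M. Lp_norm p M f < top}"

text \<open>Only meaningful where the integral converges, in particular on \<open>Re z > 0\<close> for
  \<open>f \<in> L\<^sup>p(0, \<infinity>)\<close>; elsewhere the Bochner integral is \<open>0\<close> by convention. On the comb this
  can only concern the left endpoints of the teeth, a null set.\<close>

definition laplace :: "(real \<Rightarrow> complex) \<Rightarrow> complex \<Rightarrow> complex" where
  "laplace f z = (\<integral>t. f t * exp (- z * complex_of_real t) \<partial>lebesgue_on {0<..})"

definition comb :: "real \<Rightarrow> complex set" where
  "comb b = (\<Union>n::int. closed_segment (\<i> * of_int n) (\<i> * of_int n + complex_of_real b))"

text \<open>Arclength on the comb: the image of the product of counting measure on the integers and
  Lebesgue measure on \<open>[0, b]\<close> under the arclength parametrisation \<open>(n, x) \<mapsto> x + \<i>n\<close>.\<close>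

definition comb_arclength :: "real \<Rightarrow> complex measure" where
  "comb_arclength b =
     distr (count_space (UNIV :: int set) \<Otimes>\<^sub>M restrict_space lborel {0..b})
       (restrict_space borel (comb b))
       (\<lambda>(n, x). complex_of_real x + \<i> * of_int n)"

lemma comb_eq:
  assumes "0 \<le> b"
  shows "comb b = {complex_of_real x + \<i> * of_int n | x n. 0 \<le> x \<and> x \<le> b}"
proof -
  have seg: "closed_segment (\<i> * of_int n) (\<i> * of_int n + complex_of_real b) =
      (\<lambda>x. complex_of_real x + \<i> * of_int n) ` {0..b}" for n
  proof -
    have "closed_segment (\<i> * of_int n) (\<i> * of_int n + complex_of_real b) =
        (+) (\<i> * of_int n) ` closed_segment 0 (complex_of_real b)"
      using closed_segment_translation[of "\<i> * of_int n" 0 "complex_of_real b"] by simp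
    also have "closed_segment 0 (complex_of_real b) = complex_of_real ` {0..b}"
      using closed_segment_of_real[of 0 b, where 'a = complex] assms
      by (simp add: closed_segment_eq_real_ivl)
    finally show ?thesis by (simp add: image_image add.commute)
  qed
  show ?thesis unfolding comb_def seg by (auto simp: image_iff) (metis atLeastAtMost_iff)
qed

lemma measurable_comb_param:
  assumes "0 \<le> b"
  shows "(\<lambda>(n, x). complex_of_real x + \<i> * of_int n)
    \<in> count_space (UNIV :: int set) \<Otimes>\<^sub>M restrict_space lborel {0..b}
      \<rightarrow>\<^sub>M restrict_space borel (comb b)"
proof (rule measurable_restrict_space2)
  show "(\<lambda>(n, x). complex_of_real x + \<i> * of_int n)
    \<in> space (count_space (UNIV :: int set) \<Otimes>\<^sub>M restrict_space lborel {0..b}) \<rightarrow> comb b"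
    by (auto simp: comb_eq[OF assms] space_pair_measure space_restrict_space)
  have [measurable]: "(\<lambda>x. x) \<in> restrict_space lborel {0..b} \<rightarrow>\<^sub>M borel"
    by (rule measurable_restrict_space1) simp
  show "(\<lambda>(n, x). complex_of_real x + \<i> * of_int n)
    \<in> count_space (UNIV :: int set) \<Otimes>\<^sub>M restrict_space lborel {0..b} \<rightarrow>\<^sub>M borel"
    by measurable
qed

lemma nn_integral_comb_arclength:
  assumes "0 \<le> b" and g: "g \<in> borel_measurable (restrict_space borel (comb b))"
  shows "(\<integral>\<^sup>+z. g z \<partial>comb_arclength b) =
    (\<integral>\<^sup>+n. (\<integral>\<^sup>+x\<in>{0..b}. g (complex_of_real x + \<i> * of_int n) \<partial>lborel) \<partial>count_space (UNIV :: int set))"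
proof -
  note [measurable] = measurable_comb_param[OF assms(1)] g
  interpret sigma_finite_measure "restrict_space lborel {0..b}"
    by (rule sigma_finite_measure_restrict_space) (auto intro: lborel.sigma_finite_measure_axioms)
  have "(\<integral>\<^sup>+z. g z \<partial>comb_arclength b) =
    (\<integral>\<^sup>+y. g (case y of (n, x) \<Rightarrow> complex_of_real x + \<i> * of_int n)
      \<partial>(count_space (UNIV :: int set) \<Otimes>\<^sub>M restrict_space lborel {0..b}))"
    unfolding comb_arclength_def by (rule nn_integral_distr) measurable
  also have "\<dots> = (\<integral>\<^sup>+n. (\<integral>\<^sup>+x. g (complex_of_real x + \<i> * of_int n)
      \<partial>restrict_space lborel {0..b}) \<partial>count_space (UNIV :: int set))"
    by (subst nn_integral_fst[symmetric])
      (simp_all add: measurable_compose[OF measurable_comb_param[OF assms(1)] g])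
  finally show ?thesis by (simp add: nn_integral_restrict_space)
qed

lemma Lp_norm_comb_arclength:
  assumes "0 \<le> b" and "0 < q" and "g \<in> borel_measurable (restrict_space borel (comb b))"
  shows "Lp_norm (ennreal q) (comb_arclength b) g =
    epowr (\<integral>\<^sup>+n. (\<integral>\<^sup>+x\<in>{0..b}.
      ennreal (norm (g (complex_of_real x + \<i> * of_int n)) powr q) \<partial>lborel) \<partial>count_space (UNIV :: int set)) (1 / q)"
  using assms by (simp add: Lp_norm_def nn_integral_comb_arclength)

end

theory Submission
  imports Defs
begin

text \<open>
  Trivially \<open>\<bar>\<L> f(z)\<bar> \<le> \<parallel>f\<parallel>\<^sub>1\<close> on \<open>Re z \<ge> 0\<close>. For \<open>p = 2\<close>, cut \<open>(0, \<infinity>)\<close> into the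
  intervals \<open>I\<^sub>k = (2\<pi>k, 2\<pi>(k+1)]\<close>: for fixed \<open>x\<close> the contributions of \<open>I\<^sub>k\<close> to \<open>\<L> f(x + in)\<close>,
  \<open>n \<in> \<int>\<close>, are Fourier coefficients, so Bessel's inequality bounds their squares. The intervals are
  recombined by a Schur test (Cauchy-Schwarz with weights \<open>sqrt (k + 1)\<close>), and integrating over \<open>x\<close>
  costs only the integral \<open>\<Gamma>(1/2)\<close>. The exponents \<open>1 < p < 2\<close> follow by Marcinkiewicz interpolation
  between these two bounds, which avoids the Riesz-Thorin theorem since the constant is irrelevant.
\<close>

section \<open>Schur weights and sums over the integers\<close>

text \<open>Euler's integral for \<open>Gamma (1/2)\<close>, rescaled. It serves twice: to sum the
  Schur weights at a fixed abscissa \<open>x\<close>, and, with \<open>1 + t\<close> in the role of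
  \<open>x\<close>, to integrate the abscissa out.\<close>

lemma nn_integral_powr_exp:
  fixes x :: real
  assumes "0 < x"
  shows "(\<integral>\<^sup>+u\<in>{0<..}. ennreal (u powr (-1/2) * exp (-(x * u))) \<partial>lborel) =
    ennreal (Gamma (1/2) * x powr (-1/2))"
proof -
  have 1: "(\<integral>\<^sup>+u. ennreal (u powr (1/2 - 1) / exp u * indicator {0..} u) \<partial>lborel) = ennreal (Gamma (1/2))"
  proof (rule nn_integral_has_integral_lborel)
    have "((\<lambda>t. if t \<in> {0..} then t powr (1/2 - 1) / exp t else 0) has_integral Gamma (1/2 :: real)) UNIV"
      using Gamma_integral_real[of "1/2"] by (subst has_integral_restrict_UNIV) simp
    moreover have "(\<lambda>t::real. if t \<in> {0..} then t powr (1/2 - 1) / exp t else 0) =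
        (\<lambda>t. t powr (1/2 - 1) / exp t * indicator {0..} t)"
      by (auto simp: indicator_def)
    ultimately show "((\<lambda>t::real. t powr (1/2 - 1) / exp t * indicator {0..} t) has_integral Gamma (1/2)) UNIV"
      by simp
  qed auto
  \<comment> \<open>The indicators of the closed and the open half-line differ only at
    \<open>0\<close>, where \<open>powr\<close> takes the value \<open>0\<close>.\<close>
  have "ennreal (Gamma (1/2)) = (\<integral>\<^sup>+u. ennreal (u powr (-1/2) / exp u * indicator {0<..} u) \<partial>lborel)"
    unfolding 1[symmetric] by (intro nn_integral_cong) (auto simp: indicator_def)
  also have "\<dots> = ennreal x * (\<integral>\<^sup>+u. ennreal ((x * u) powr (-1/2) / exp (x * u) * indicator {0<..} (x * u)) \<partial>lborel)"
    using assms by (subst nn_integral_real_affine[where c = x and t = 0]) auto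
  also have "(\<integral>\<^sup>+u. ennreal ((x * u) powr (-1/2) / exp (x * u) * indicator {0<..} (x * u)) \<partial>lborel)
     = (\<integral>\<^sup>+u. ennreal (x powr (-1/2)) * (ennreal (u powr (-1/2) * exp (-(x * u))) * indicator {0<..} u) \<partial>lborel)"
    using assms by (intro nn_integral_cong)
      (auto simp: indicator_def powr_mult exp_minus field_simps zero_less_mult_iff ennreal_mult[symmetric])
  also have "\<dots> = ennreal (x powr (-1/2)) * (\<integral>\<^sup>+u\<in>{0<..}. ennreal (u powr (-1/2) * exp (-(x * u))) \<partial>lborel)"
    by (rule nn_integral_cmult) measurable
  finally have "ennreal (Gamma (1/2)) * ennreal (x powr (-1/2)) =
     ennreal (x * x powr (-1/2) * x powr (-1/2)) * (\<integral>\<^sup>+u\<in>{0<..}. ennreal (u powr (-1/2) * exp (-(x * u))) \<partial>lborel)"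
    using assms by (simp add: ennreal_mult' mult_ac)
  also have "x * x powr (-1/2) * x powr (-1/2) = 1"
    using assms by (simp add: powr_minus powr_half_sqrt field_simps)
  finally show ?thesis
    by (simp add: ennreal_mult'' Gamma_real_nonneg)
qed

text \<open>Integral test: \<open>u powr (-1/2) * exp (-(x * u))\<close> decreases, so its value at
  \<open>k + 1\<close> is at most its integral over \<open>{k<..k + 1}\<close>. Since
  \<open>2 * pi \<ge> 1\<close>, the exponential may be weakened to \<open>exp (-(k * x))\<close>,
  and shifting \<open>k\<close> to \<open>k + 1\<close> there costs a factor
  \<open>exp x \<le> exp b\<close>.\<close>

lemma suminf_exp_weight_le:
  fixes x b :: real
  assumes "0 < x" "x \<le> b"
  shows "(\<Sum>k. ennreal (exp (-(2 * pi * k * x)) * (real k + 1) powr (-1/2)))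
    \<le> ennreal (exp b * (Gamma (1/2) * x powr (-1/2)))"
proof -
  have "ennreal (exp (-(2 * pi * k * x)) * (real k + 1) powr (-1/2)) \<le>
     ennreal (exp b) * (\<integral>\<^sup>+u\<in>{real k<..real k + 1}. ennreal (u powr (-1/2) * exp (-(x * u))) \<partial>lborel)" for k
  proof -
    have "k * x \<le> 2 * pi * k * x"
      using assms pi_gt3 by (intro mult_right_mono) (auto simp: mult_le_cancel_right1)
    then have "exp (-(2 * pi * k * x)) \<le> exp b * exp (-(x * (real k + 1)))"
      using assms unfolding exp_add[symmetric] by (simp add: mult.commute[of x] distrib_right)
    then have "ennreal (exp (-(2 * pi * k * x)) * (real k + 1) powr (-1/2))
      \<le> ennreal (exp b) * ennreal ((real k + 1) powr (-1/2) * exp (-(x * (real k + 1))))"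
      by (subst ennreal_mult[symmetric]) (auto intro!: ennreal_leI mult_right_mono simp: mult_ac)
    also have "ennreal ((real k + 1) powr (-1/2) * exp (-(x * (real k + 1))))
      = (\<integral>\<^sup>+u\<in>{real k<..real k + 1}. ennreal ((real k + 1) powr (-1/2) * exp (-(x * (real k + 1)))) \<partial>lborel)"
      by (simp add: nn_integral_cmult_indicator)
    also have "\<dots> \<le> (\<integral>\<^sup>+u\<in>{real k<..real k + 1}. ennreal (u powr (-1/2) * exp (-(x * u))) \<partial>lborel)"
      using assms by (intro nn_integral_mono)
        (auto simp: indicator_def intro!: ennreal_leI mult_mono powr_mono2')
    finally show ?thesis by (simp add: mult_left_mono)
  qed
  then have "(\<Sum>k. ennreal (exp (-(2 * pi * k * x)) * (real k + 1) powr (-1/2)))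
    \<le> (\<Sum>k. ennreal (exp b) * (\<integral>\<^sup>+u\<in>{real k<..real k + 1}. ennreal (u powr (-1/2) * exp (-(x * u))) \<partial>lborel))"
    by (intro suminf_le) auto
  also have "\<dots> = ennreal (exp b) * (\<Sum>k. \<integral>\<^sup>+u\<in>{real k<..real k + 1}. ennreal (u powr (-1/2) * exp (-(x * u))) \<partial>lborel)"
    by simp
  also have "(\<Sum>k. \<integral>\<^sup>+u\<in>{real k<..real k + 1}. ennreal (u powr (-1/2) * exp (-(x * u))) \<partial>lborel)
     = (\<integral>\<^sup>+u\<in>(\<Union>k. {real k<..real k + 1}). ennreal (u powr (-1/2) * exp (-(x * u))) \<partial>lborel)"
  proof (rule nn_integral_disjoint_family[symmetric])
    show "disjoint_family (\<lambda>k. {real k<..real k + 1})"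
      by (auto simp: disjoint_family_on_def)
  qed auto
  also have "\<dots> \<le> (\<integral>\<^sup>+u\<in>{0<..}. ennreal (u powr (-1/2) * exp (-(x * u))) \<partial>lborel)"
    by (intro nn_integral_mono) (auto simp: indicator_def)
  also have "\<dots> = ennreal (Gamma (1/2) * x powr (-1/2))"
    by (rule nn_integral_powr_exp[OF assms(1)])
  finally show ?thesis
    by (simp add: ennreal_mult' mult_left_mono)
qed

text \<open>Cauchy-Schwarz after splitting \<open>norm (B k)\<close> into \<open>sqrt (v k)\<close>
  times \<open>norm (B k) / sqrt (v k)\<close>. The bound on partial sums is independent of
  \<open>N\<close> and so passes to the limit.\<close>

lemma norm_sums_power2_le:
  fixes B :: "nat \<Rightarrow> 'a::real_normed_vector" and v :: "nat \<Rightarrow> real"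
  assumes "B sums F" and v: "\<And>k. 0 < v k" "(\<Sum>k. ennreal (v k)) \<le> V"
  shows "ennreal ((norm F)\<^sup>2) \<le> V * (\<Sum>k. ennreal ((norm (B k))\<^sup>2 / v k))"
proof (rule LIMSEQ_le_const2)
  show "(\<lambda>N. ennreal ((norm (\<Sum>k<N. B k))\<^sup>2)) \<longlonglongrightarrow> ennreal ((norm F)\<^sup>2)"
    using assms(1) unfolding sums_def by (intro tendsto_intros)
  have "ennreal ((norm (\<Sum>k<N. B k))\<^sup>2) \<le> V * (\<Sum>k. ennreal ((norm (B k))\<^sup>2 / v k))" for N
  proof -
    have "(norm (\<Sum>k<N. B k))\<^sup>2 \<le> (\<Sum>k<N. sqrt (v k) * (norm (B k) / sqrt (v k)))\<^sup>2"
      using v(1) by (intro power_mono) (auto intro!: sum_norm_le simp: less_imp_neq[symmetric])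
    also have "\<dots> \<le> (\<Sum>k<N. (sqrt (v k))\<^sup>2) * (\<Sum>k<N. (norm (B k) / sqrt (v k))\<^sup>2)"
      by (rule Cauchy_Schwarz_ineq_sum)
    also have "\<dots> = (\<Sum>k<N. v k) * (\<Sum>k<N. (norm (B k))\<^sup>2 / v k)"
      using v(1) by (simp add: power_divide less_imp_le)
    finally have "ennreal ((norm (\<Sum>k<N. B k))\<^sup>2) \<le> ennreal ((\<Sum>k<N. v k) * (\<Sum>k<N. (norm (B k))\<^sup>2 / v k))"
      by (rule ennreal_leI)
    also have "\<dots> = (\<Sum>k<N. ennreal (v k)) * (\<Sum>k<N. ennreal ((norm (B k))\<^sup>2 / v k))"
      using v(1) by (simp add: ennreal_mult sum_nonneg less_imp_le)
    also have "\<dots> \<le> (\<Sum>k. ennreal (v k)) * (\<Sum>k. ennreal ((norm (B k))\<^sup>2 / v k))"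
      by (intro mult_mono sum_le_suminf) auto
    also have "\<dots> \<le> V * (\<Sum>k. ennreal ((norm (B k))\<^sup>2 / v k))"
      by (intro mult_right_mono v) auto
    finally show ?thesis .
  qed
  then show "\<exists>N. \<forall>n\<ge>N. ennreal ((norm (\<Sum>k<n. B k))\<^sup>2) \<le> V * (\<Sum>k. ennreal ((norm (B k))\<^sup>2 / v k))"
    by blast
qed

text \<open>Bessel's inequality controls finite sums. Enumerating the integers gives a series whose
  partial sums are of that kind.\<close>

lemma nn_integral_count_space_int_le:
  fixes g :: "int \<Rightarrow> ennreal"
  assumes "\<And>S. finite S \<Longrightarrow> (\<Sum>n\<in>S. g n) \<le> c"
  shows "(\<integral>\<^sup>+n. g n \<partial>count_space UNIV) \<le> c"
proof -
  have "(\<integral>\<^sup>+n. g n \<partial>count_space UNIV) = (\<Sum>k. g (from_nat_into UNIV k))"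
    using nn_integral_bij_count_space[of "from_nat_into UNIV" UNIV "UNIV :: int set" g]
    by (simp add: bij_betw_from_nat_into infinite_UNIV_int nn_integral_count_space_nat)
  also have "\<dots> \<le> c"
  proof (rule suminf_le_const)
    fix N
    have "inj (from_nat_into (UNIV :: int set))"
      using bij_betw_from_nat_into[of "UNIV :: int set"] by (simp add: bij_betw_def infinite_UNIV_int)
    then have "(\<Sum>k<N. g (from_nat_into UNIV k)) = (\<Sum>n\<in>from_nat_into UNIV ` {..<N}. g n)"
      by (subst sum.reindex) (auto intro: inj_on_subset)
    also have "\<dots> \<le> c" by (intro assms) auto
    finally show "(\<Sum>k<N. g (from_nat_into UNIV k)) \<le> c" .
  qed auto
  finally show ?thesis .
qed

section \<open>Bessel's inequality\<close>

lemma borel_measurable_cnj [measurable]: "cnj \<in> borel_measurable borel"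
  by (intro borel_measurable_continuous_onI continuous_intros)

text \<open>From \<open>2ab \<le> a^2 + b^2\<close>. It justifies splitting the integrals in
  Bessel's inequality and the convergence of the Laplace integral of an L^2 function.\<close>

lemma integrable_mult_cnj:
  fixes u v :: "'a \<Rightarrow> complex"
  assumes [measurable]: "u \<in> borel_measurable M" "v \<in> borel_measurable M"
    and "integrable M (\<lambda>t. (cmod (u t))\<^sup>2)" "integrable M (\<lambda>t. (cmod (v t))\<^sup>2)"
  shows "integrable M (\<lambda>t. u t * cnj (v t))"
proof (rule Bochner_Integration.integrable_bound)
  show "integrable M (\<lambda>t. (cmod (u t))\<^sup>2 + (cmod (v t))\<^sup>2)"
    using assms by simp
  have "cmod (u t) * cmod (v t) \<le> (cmod (u t))\<^sup>2 + (cmod (v t))\<^sup>2" for t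
  proof -
    have "0 \<le> cmod (u t) * cmod (v t)" by simp
    then show ?thesis using sum_squares_bound[of "cmod (u t)" "cmod (v t)"] by linarith
  qed
  then show "AE t in M. norm (u t * cnj (v t)) \<le> norm ((cmod (u t))\<^sup>2 + (cmod (v t))\<^sup>2)"
    by (simp add: norm_mult)
qed measurable

text \<open>Expand the nonnegative integral of \<open>|g - s|^2\<close>, where \<open>s\<close> is
  the orthogonal projection of \<open>g\<close> onto the span of the \<open>e n\<close>,
  \<open>n \<in> S\<close>. The \<open>e n\<close> have squared norm \<open>c\<close>, which
  explains the coefficients \<open>a n / c\<close>.\<close>

lemma Bessel_inequality:
  fixes g :: "'a \<Rightarrow> complex" and e :: "'i \<Rightarrow> 'a \<Rightarrow> complex" and c :: real
  assumes [measurable]: "g \<in> borel_measurable M" "\<And>n. e n \<in> borel_measurable M"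
    and g: "integrable M (\<lambda>t. (cmod (g t))\<^sup>2)"
    and e: "\<And>n. integrable M (\<lambda>t. (cmod (e n t))\<^sup>2)"
    and orth: "\<And>m n. (\<integral>t. e m t * cnj (e n t) \<partial>M) = (if m = n then of_real c else 0)"
    and c: "0 < c" and S: "finite S"
  shows "(\<Sum>n\<in>S. (cmod (\<integral>t. g t * cnj (e n t) \<partial>M))\<^sup>2) \<le> c * (\<integral>t. (cmod (g t))\<^sup>2 \<partial>M)"
proof -
  define a where "a n = (\<integral>t. g t * cnj (e n t) \<partial>M)" for n
  define s where "s t = (\<Sum>n\<in>S. a n / c * e n t)" for t
  have int: "integrable M (\<lambda>t. g t * cnj (g t))" "integrable M (\<lambda>t. g t * cnj (e n t))"
    "integrable M (\<lambda>t. e n t * cnj (g t))" "integrable M (\<lambda>t. e m t * cnj (e n t))" for m n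
    by (intro integrable_mult_cnj g e; measurable)+
  have cnj_a: "(\<integral>t. e n t * cnj (g t) \<partial>M) = cnj (a n)" for n
    unfolding a_def Bochner_Integration.integral_cnj[symmetric] by (simp add: mult.commute)
  have "complex_of_real ((cmod (g t - s t))\<^sup>2) = g t * cnj (g t)
      - (\<Sum>n\<in>S. cnj (a n) / c * (g t * cnj (e n t)))
      - (\<Sum>n\<in>S. a n / c * (e n t * cnj (g t)))
      + (\<Sum>m\<in>S. \<Sum>n\<in>S. a m * cnj (a n) / (c * c) * (e m t * cnj (e n t)))" for t
    unfolding complex_norm_square s_def
    by (simp add: cnj_sum algebra_simps sum_product sum_distrib_left) (rule sum.swap)
  then have "(\<integral>t. complex_of_real ((cmod (g t - s t))\<^sup>2) \<partial>M) = (\<integral>t. g t * cnj (g t)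
      - (\<Sum>n\<in>S. cnj (a n) / c * (g t * cnj (e n t)))
      - (\<Sum>n\<in>S. a n / c * (e n t * cnj (g t)))
      + (\<Sum>m\<in>S. \<Sum>n\<in>S. a m * cnj (a n) / (c * c) * (e m t * cnj (e n t))) \<partial>M)"
    by (simp only:)
  also have "\<dots> = (\<integral>t. g t * cnj (g t) \<partial>M)
      - (\<Sum>n\<in>S. cnj (a n) / c * a n) - (\<Sum>n\<in>S. a n / c * cnj (a n))
      + (\<Sum>m\<in>S. \<Sum>n\<in>S. a m * cnj (a n) / (c * c) * (if m = n then of_real c else 0))"
    by (simp add: int a_def[symmetric] cnj_a orth)
  \<comment> \<open>By orthogonality only the diagonal of the double sum survives; it cancels one of
    the two equal cross sums.\<close>
  also have "\<dots> = (\<integral>t. complex_of_real ((cmod (g t))\<^sup>2) \<partial>M) - (\<Sum>n\<in>S. complex_of_real ((cmod (a n))\<^sup>2)) / c"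
    using S c unfolding complex_norm_square by (simp add: if_distrib cong: if_cong) (simp add: sum_divide_distrib mult.commute)
  finally have "(\<integral>t. (cmod (g t - s t))\<^sup>2 \<partial>M) = (\<integral>t. (cmod (g t))\<^sup>2 \<partial>M) - (\<Sum>n\<in>S. (cmod (a n))\<^sup>2) / c"
    unfolding integral_complex_of_real of_real_sum[symmetric] of_real_divide[symmetric] of_real_diff[symmetric]
    by (simp only: of_real_eq_iff)
  moreover have "0 \<le> (\<integral>t. (cmod (g t - s t))\<^sup>2 \<partial>M)" by simp
  ultimately have "(\<Sum>n\<in>S. (cmod (a n))\<^sup>2) / c \<le> (\<integral>t. (cmod (g t))\<^sup>2 \<partial>M)"
    by linarith
  then show ?thesis
    using c by (simp add: a_def pos_divide_le_eq mult.commute)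
qed

lemma borel_measurable_cis [measurable]: "cis \<in> borel_measurable borel"
  by (intro borel_measurable_continuous_onI continuous_intros)

lemma integral_cis_period:
  fixes a :: real and m :: int
  assumes "0 \<le> a"
  shows "(\<integral>t. indicator {a<..a + 2 * pi} t * cis (m * t) \<partial>lebesgue_on {0<..}) = (if m = 0 then 2 * pi else 0)"
proof -
  have "(\<integral>t. indicator {a<..a + 2 * pi} t * cis (m * t) \<partial>lebesgue_on {0<..})
    = (\<integral>t. indicator {0<..} t *\<^sub>R (indicator {a<..a + 2 * pi} t * cis (m * t)) \<partial>lebesgue)"
    by (rule Bochner_Integration.integral_restrict_space) simp
  also have "\<dots> = (\<integral>t. indicator {0<..} t *\<^sub>R (indicator {a<..a + 2 * pi} t * cis (m * t)) \<partial>lborel)"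
    by (rule integral_completion) measurable
  \<comment> \<open>Adding the single point \<open>a\<close> closes the interval, as the fundamental
    theorem of calculus requires; \<open>0 \<le> a\<close> keeps the original interval inside the
    half-line.\<close>
  also have "\<dots> = (\<integral>t. indicator {a..a + 2 * pi} t *\<^sub>R cis (m * t) \<partial>lborel)"
  proof (rule integral_cong_AE)
    show "AE t in lborel. indicator {0<..} t *\<^sub>R (indicator {a<..a + 2 * pi} t * cis (m * t)) =
        indicator {a..a + 2 * pi} t *\<^sub>R cis (m * t)"
      using AE_lborel_singleton[of a] by eventually_elim (use assms in \<open>auto simp: indicator_def\<close>)
  qed measurable
  also have "\<dots> = (if m = 0 then 2 * pi else 0)"
  proof (cases "m = 0")
    case False
    have "(\<integral>t. indicator {a..a + 2 * pi} t *\<^sub>R cis (m * t) \<partial>lborel) =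
        cis (m * (a + 2 * pi)) / (\<i> * m) - cis (m * a) / (\<i> * m)"
    proof (rule integral_FTC_Icc)
      fix x :: real
      have "((\<lambda>z. exp (\<i> * m * z) / (\<i> * m)) has_field_derivative exp (\<i> * m * of_real x)) (at (of_real x))"
        using False by (auto intro!: derivative_eq_intros)
      from has_vector_derivative_real_field[OF this]
      show "((\<lambda>t. cis (m * t) / (\<i> * m)) has_vector_derivative cis (m * x)) (at x within {a..a + 2 * pi})"
        by (simp add: cis_conv_exp mult.assoc)
    qed (auto intro!: continuous_intros)
    \<comment> \<open>As \<open>m\<close> is an integer, the primitive agrees at both ends of the
      period.\<close>
    also have "cis (m * (a + 2 * pi)) = cis (m * a)"
      using cis_multiple_2pi[of m] by (simp add: distrib_left cis_mult[symmetric] mult_ac)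
    finally show ?thesis using False by simp
  qed (simp add: scaleR_conv_of_real)
  finally show ?thesis .
qed

text \<open>The exponentials cut to one period are orthogonal with squared norm
  \<open>2 * pi\<close>. If the right side is infinite nothing is to be shown; otherwise the cut
  \<open>g\<close> is square integrable and Bessel's inequality applies for every finite set of
  frequencies.\<close>

lemma Bessel_interval:
  fixes a :: real and g :: "real \<Rightarrow> complex"
  assumes "0 \<le> a" and [measurable]: "g \<in> borel_measurable (lebesgue_on {0<..})"
  shows "(\<integral>\<^sup>+n. ennreal ((cmod (\<integral>t. indicator {a<..a + 2 * pi} t *\<^sub>R (g t * cis (- (of_int n * t))) \<partial>lebesgue_on {0<..}))\<^sup>2)
      \<partial>count_space (UNIV :: int set))
    \<le> ennreal (2 * pi) * (\<integral>\<^sup>+t\<in>{a<..a + 2 * pi}. ennreal ((cmod (g t))\<^sup>2) \<partial>lebesgue_on {0<..})"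
proof (cases "(\<integral>\<^sup>+t\<in>{a<..a + 2 * pi}. ennreal ((cmod (g t))\<^sup>2) \<partial>lebesgue_on {0<..}) < \<infinity>")
  case False
  then show ?thesis by (simp add: less_top[symmetric] ennreal_mult_top)
next
  case True
  define I where "I = {a<..a + 2 * pi}"
  define h where "h t = indicator I t *\<^sub>R g t" for t
  define e where "e n t = complex_of_real (indicator I t) * cis (of_int n * t)" for n :: int and t
  have I [measurable]: "I \<in> sets (lebesgue_on {0<..})"
    using assms(1) unfolding I_def by (subst sets_restrict_space_iff) auto
  have I_sub: "I \<subseteq> {0<..}"
    using assms(1) by (auto simp: I_def)
  have id [measurable]: "(\<lambda>x. x) \<in> borel_measurable (lebesgue_on {0<..})"
    using id_borel_measurable_lebesgue_on[of "{0<..}"] by (simp add: id_def)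
  have [measurable]: "h \<in> borel_measurable (lebesgue_on {0<..})"
    "e n \<in> borel_measurable (lebesgue_on {0<..})" for n
    unfolding h_def e_def by measurable
  have h: "(\<integral>\<^sup>+t. ennreal ((cmod (h t))\<^sup>2) \<partial>lebesgue_on {0<..}) =
      (\<integral>\<^sup>+t\<in>I. ennreal ((cmod (g t))\<^sup>2) \<partial>lebesgue_on {0<..})"
    unfolding h_def by (intro nn_integral_cong) (auto simp: indicator_def)
  have int_h: "integrable (lebesgue_on {0<..}) (\<lambda>t. (cmod (h t))\<^sup>2)"
    using True by (intro integrableI_nonneg) (auto simp: h I_def)
  have emb: "emeasure (lebesgue_on {0<..}) I < \<infinity>"
    using assms(1) by (subst emeasure_restrict_space) (auto simp: I_def)
  have int_e: "integrable (lebesgue_on {0<..}) (\<lambda>t. (cmod (e n t))\<^sup>2)" for n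
  proof -
    have "(\<lambda>t. (cmod (e n t))\<^sup>2) = indicator I"
      by (auto simp: e_def indicator_def norm_mult)
    then show ?thesis using emb I by (simp add: integrable_indicator_iff Int_absorb2 I_sub)
  qed
  have orth: "(\<integral>t. e m t * cnj (e n t) \<partial>lebesgue_on {0<..}) = (if m = n then of_real (2 * pi) else 0)" for m n
  proof -
    have "(\<lambda>t. e m t * cnj (e n t)) = (\<lambda>t. indicator I t * cis (of_int (m - n) * t))"
      by (auto simp: e_def indicator_def cis_cnj cis_mult algebra_simps)
    then show ?thesis using integral_cis_period[OF assms(1), of "m - n"] by (simp add: I_def)
  qed
  have eq: "indicator I t *\<^sub>R (g t * cis (- (of_int n * t))) = h t * cnj (e n t)" for n :: int and t
    by (simp add: h_def e_def cis_cnj indicator_def)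
  show ?thesis unfolding I_def[symmetric] eq
  proof (rule nn_integral_count_space_int_le)
    fix S :: "int set" assume "finite S"
    then have "(\<Sum>n\<in>S. (cmod (\<integral>t. h t * cnj (e n t) \<partial>lebesgue_on {0<..}))\<^sup>2)
        \<le> 2 * pi * (\<integral>t. (cmod (h t))\<^sup>2 \<partial>lebesgue_on {0<..})"
      by (intro Bessel_inequality int_h int_e orth) auto
    then have "(\<Sum>n\<in>S. ennreal ((cmod (\<integral>t. h t * cnj (e n t) \<partial>lebesgue_on {0<..}))\<^sup>2))
        \<le> ennreal (2 * pi) * ennreal (\<integral>t. (cmod (h t))\<^sup>2 \<partial>lebesgue_on {0<..})"
      by (simp add: ennreal_mult[symmetric] ennreal_leI)
    also have "ennreal (\<integral>t. (cmod (h t))\<^sup>2 \<partial>lebesgue_on {0<..}) = (\<integral>\<^sup>+t. ennreal ((cmod (h t))\<^sup>2) \<partial>lebesgue_on {0<..})"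
      by (rule nn_integral_eq_integral[symmetric, OF int_h]) simp
    finally show "(\<Sum>n\<in>S. ennreal ((cmod (\<integral>t. h t * cnj (e n t) \<partial>lebesgue_on {0<..}))\<^sup>2))
        \<le> ennreal (2 * pi) * (\<integral>\<^sup>+t\<in>I. ennreal ((cmod (g t))\<^sup>2) \<partial>lebesgue_on {0<..})"
      unfolding h .
  qed
qed

section \<open>Measures on the half-line and on the comb\<close>

abbreviation pos_lebesgue :: "real measure" where
  "pos_lebesgue \<equiv> lebesgue_on {0<..}"

abbreviation comb_domain :: "real \<Rightarrow> (int \<times> real) measure" where
  "comb_domain b \<equiv> count_space UNIV \<Otimes>\<^sub>M restrict_space lborel {0..b}"

abbreviation comb_param :: "int \<times> real \<Rightarrow> complex" where
  "comb_param \<equiv> \<lambda>(n, x). complex_of_real x + \<i> * of_int n"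

text \<open>The same countable cover works, as completion preserves measurable sets and their
  measures. This opens Fubini's theorem to \<open>pos_lebesgue\<close>.\<close>

lemma sigma_finite_measure_completion:
  assumes "sigma_finite_measure M"
  shows "sigma_finite_measure (completion M)"
proof -
  interpret sigma_finite_measure M by fact
  obtain A where "countable A" "A \<subseteq> sets M" "(\<Union>A) = space M" "\<forall>a\<in>A. emeasure M a \<noteq> \<infinity>"
    using sigma_finite_countable by blast
  then show ?thesis
    by (intro sigma_finite_measure.intro exI[of _ A]) (auto intro: sets_completionI_sets)
qed

lemma sigma_finite_pos_lebesgue: "sigma_finite_measure pos_lebesgue"
  by (intro sigma_finite_measure_restrict_space sigma_finite_measure_completion sigma_finite_lborel) simp

lemma sigma_finite_restrict_lborel: "sigma_finite_measure (restrict_space lborel {0..b::real})"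
  by (intro sigma_finite_measure_restrict_space sigma_finite_lborel) simp

lemma sigma_finite_count_space_int: "sigma_finite_measure (count_space (UNIV :: int set))"
  by (rule sigma_finite_measure_count_space_countable) auto

lemma sigma_finite_comb_domain: "sigma_finite_measure (comb_domain b)"
  by (intro sigma_finite_pair_measure sigma_finite_count_space_int sigma_finite_restrict_lborel)

lemma measurable_ident_pos_lebesgue [measurable]: "(\<lambda>t. t) \<in> borel_measurable pos_lebesgue"
  using id_borel_measurable_lebesgue_on[of "{0<..}"] by (simp add: id_def)

section \<open>The Laplace transform on the comb\<close>

text \<open>A parameter integral over a sigma-finite measure. Points \<open>z\<close> where the
  integral diverges are covered as well, the Bochner integral being \<open>0\<close> there.\<close>

lemma borel_measurable_laplace:
  assumes [measurable]: "f \<in> borel_measurable pos_lebesgue"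
  shows "laplace f \<in> borel_measurable borel"
proof -
  interpret sigma_finite_measure pos_lebesgue by (rule sigma_finite_pos_lebesgue)
  show ?thesis unfolding laplace_def by measurable
qed

lemma comb_param_measurable [measurable]: "comb_param \<in> comb_domain b \<rightarrow>\<^sub>M borel"
proof -
  have [measurable]: "(\<lambda>x. x) \<in> restrict_space lborel {0..b} \<rightarrow>\<^sub>M borel"
    by (rule measurable_restrict_space1) simp
  show ?thesis by measurable
qed

text \<open>At a fixed abscissa \<open>x\<close> the values over all \<open>n\<close> are Fourier
  integrals of one damped function, which is what Bessel's inequality acts on.\<close>

lemma laplace_comb:
  "laplace g (complex_of_real x + \<i> * of_int n) =
    (\<integral>t. g t * complex_of_real (exp (- (x * t))) * cis (- (of_int n * t)) \<partial>pos_lebesgue)"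
  unfolding laplace_def
  by (intro Bochner_Integration.integral_cong)
    (simp_all add: cis_conv_exp exp_of_real[symmetric] exp_add[symmetric] algebra_simps)

text \<open>For \<open>x > 0\<close> the exponential is itself square integrable on the half-line,
  so this is a product of two L^2 functions.\<close>

lemma integrable_mult_exp:
  fixes g :: "real \<Rightarrow> complex"
  assumes [measurable]: "g \<in> borel_measurable pos_lebesgue"
    and g: "(\<integral>\<^sup>+t. ennreal ((cmod (g t))\<^sup>2) \<partial>pos_lebesgue) < \<infinity>" and "0 < x"
  shows "integrable pos_lebesgue (\<lambda>t. g t * complex_of_real (exp (- (x * t))))"
proof -
  have "integrable pos_lebesgue (\<lambda>t. (cmod (g t))\<^sup>2)"
    using g by (intro integrableI_nonneg) auto
  moreover have "integrable pos_lebesgue (\<lambda>t. (cmod (complex_of_real (exp (- (x * t)))))\<^sup>2)"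
  proof (rule integrableI_nonneg)
    have "(\<integral>\<^sup>+t. ennreal ((cmod (complex_of_real (exp (- (x * t)))))\<^sup>2) \<partial>pos_lebesgue)
        \<le> (\<integral>\<^sup>+t. ennreal (exp (- (2 * x) * t)) * indicator {0..} t \<partial>lebesgue)"
      by (subst nn_integral_restrict_space)
        (auto intro!: nn_integral_mono simp: indicator_def power2_eq_square exp_add[symmetric])
    also have "\<dots> = (\<integral>\<^sup>+t. ennreal (exp (- (2 * x) * t)) * indicator {0..} t \<partial>lborel)"
      by (rule nn_integral_completion)
    also have "\<dots> = ennreal (exp (- (2 * x) * 0) / (2 * x))"
      using assms(3) by (intro nn_integral_has_integral_lebesgue' has_integral_exp_minus_to_infinity) auto
    finally show "(\<integral>\<^sup>+t. ennreal ((cmod (complex_of_real (exp (- (x * t)))))\<^sup>2) \<partial>pos_lebesgue) < \<infinity>"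
      by (simp add: le_less_trans)
  qed auto
  ultimately have "integrable pos_lebesgue (\<lambda>t. g t * cnj (complex_of_real (exp (- (x * t)))))"
    by (intro integrable_mult_cnj) auto
  then show ?thesis by simp
qed

text \<open>The partial sums are the integrals over \<open>{0<..c * N}\<close>, and these sets
  increase to the half-line.\<close>

lemma set_integral_intervals_sums:
  fixes h :: "real \<Rightarrow> complex" and c :: real
  assumes "0 < c" and h: "integrable pos_lebesgue h"
  shows "(\<lambda>k. \<integral>t. indicator {c * k<..c * k + c} t *\<^sub>R h t \<partial>pos_lebesgue) sums (\<integral>t. h t \<partial>pos_lebesgue)"
proof -
  define A where "A N = {0<..c * real N}" for N
  have sets: "{a<..b} \<in> sets pos_lebesgue" if "0 \<le> a" for a b :: real
    using that by (subst sets_restrict_space_iff) auto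
  have int: "set_integrable pos_lebesgue {a<..b} h" if "0 \<le> a" for a b :: real
    unfolding set_integrable_def using sets[OF that] h by (rule integrable_mult_indicator)
  have "(LINT t:A N|pos_lebesgue. h t) = (\<Sum>k<N. LINT t:{c * real k<..c * real k + c}|pos_lebesgue. h t)" for N
  proof (induction N)
    case (Suc N)
    have "0 \<le> c * real N" using assms(1) by simp
    then have "A (Suc N) = A N \<union> {c * N<..c * N + c}"
      using assms(1) unfolding A_def of_nat_Suc distrib_left mult_1_right
      by (intro set_eqI) (simp only: greaterThanAtMost_iff Un_iff, linarith)
    moreover have "A N \<inter> {c * N<..c * N + c} = {}" by (auto simp: A_def)
    ultimately show ?case
      using assms(1) Suc by (simp add: set_integral_Un int A_def)
  qed (simp add: A_def set_lebesgue_integral_def)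
  moreover have "(\<Union>N. A N) = {0<..}"
  proof safe
    fix t :: real assume "0 < t"
    obtain N :: nat where "t / c < N" using reals_Archimedean2 by blast
    then have "t \<le> c * N" using assms(1) by (simp add: field_simps)
    then show "t \<in> (\<Union>N. A N)" using \<open>0 < t\<close> by (auto simp: A_def)
  qed (auto simp: A_def)
  moreover have "(\<lambda>N. LINT t:A N|pos_lebesgue. h t) \<longlonglongrightarrow> (LINT t:(\<Union>N. A N)|pos_lebesgue. h t)"
  proof (rule set_integral_cont_up)
    show "incseq A"
    proof (rule incseq_SucI)
      fix n
      have "c * real n \<le> c * real (Suc n)" using assms(1) by (intro mult_left_mono) auto
      then show "A n \<le> A (Suc n)"
        unfolding A_def using greaterThanAtMost_iff order_trans by (metis subsetI)
    qed
    show "set_integrable pos_lebesgue (\<Union>N. A N) h"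
      unfolding \<open>(\<Union>N. A N) = {0<..}\<close> set_integrable_def
      by (rule integrable_mult_indicator) (use h in auto)
  qed (simp add: A_def sets)
  moreover have "(LINT t:{0<..}|pos_lebesgue. h t) = (\<integral>t. h t \<partial>pos_lebesgue)"
    unfolding set_lebesgue_integral_def by (intro Bochner_Integration.integral_cong) auto
  ultimately show ?thesis
    unfolding sums_def set_lebesgue_integral_def by simp
qed

text \<open>Weighted Cauchy-Schwarz across the blocks \<open>I k\<close>, then Bessel's inequality
  in \<open>n\<close> on each block. The weights sum to a multiple of \<open>x powr (-1/2)\<close>,
  which is integrable at \<open>0\<close>; the price is the growing factor
  \<open>sqrt (1 + t)\<close>, which integration over \<open>x\<close> later removes.\<close>

lemma laplace_vertical_L2_le:
  fixes g :: "real \<Rightarrow> complex"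
  assumes x: "0 < x" "x \<le> b" and g [measurable]: "g \<in> borel_measurable pos_lebesgue"
    and fin: "(\<integral>\<^sup>+t. ennreal ((cmod (g t))\<^sup>2) \<partial>pos_lebesgue) < \<infinity>"
  shows "(\<integral>\<^sup>+n. ennreal ((cmod (laplace g (complex_of_real x + \<i> * of_int n)))\<^sup>2) \<partial>count_space UNIV)
    \<le> ennreal (exp b * (Gamma (1/2) * x powr (-1/2))) * (ennreal (2 * pi) *
       (\<integral>\<^sup>+t. ennreal (sqrt (1 + t) * exp (- (x * t)) * (cmod (g t))\<^sup>2) \<partial>pos_lebesgue))"
proof -
  define I where "I k = {2 * pi * real k<..2 * pi * real k + 2 * pi}" for k
  define V where "V = ennreal (exp b * (Gamma (1/2) * x powr (-1/2)))"
  \<comment> \<open>\<open>(cmod (h t))\<^sup>2\<close> carries the decay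
    \<open>exp (- 2 * x * t)\<close>. The weight spends half of it and leaves
    \<open>exp (- (x * t))\<close> for the integration over \<open>x\<close>.\<close>
  define v where "v k = exp (-(2 * pi * real k * x)) * (real k + 1) powr (-1/2)" for k
  define h where "h t = g t * complex_of_real (exp (- (x * t)))" for t
  define w where "w t = sqrt (1 + t) * exp (- (x * t)) * (cmod (g t))\<^sup>2" for t
  define B where "B n k = (\<integral>t. indicator (I k) t *\<^sub>R (h t * cis (- (of_int n * t))) \<partial>pos_lebesgue)" for n :: int and k
  have [measurable]: "I k \<in> sets pos_lebesgue" for k
  proof -
    have "0 \<le> 2 * pi * real k" by simp
    then have "I k \<subseteq> {0<..}"
      unfolding I_def by (intro subsetI) (simp only: greaterThanAtMost_iff greaterThan_iff, linarith)
    then show ?thesis by (subst sets_restrict_space_iff) (auto simp: I_def)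
  qed
  have [measurable]: "h \<in> borel_measurable pos_lebesgue" "w \<in> borel_measurable pos_lebesgue"
    unfolding h_def w_def by measurable
  have v_pos: "0 < v k" for k by (simp add: v_def)
  have int_h: "integrable pos_lebesgue h"
    unfolding h_def by (rule integrable_mult_exp[OF g fin x(1)])
  have int: "integrable pos_lebesgue (\<lambda>t. h t * cis (- (of_int n * t)))" for n :: int
    by (rule Bochner_Integration.integrable_bound[OF int_h]) (auto simp: norm_mult)
  have sums: "(\<lambda>k. B n k) sums laplace g (complex_of_real x + \<i> * of_int n)" for n
    unfolding B_def I_def laplace_comb h_def[symmetric]
    by (rule set_integral_intervals_sums[OF _ int]) simp
  have sum_v: "(\<Sum>k. ennreal (v k)) \<le> V"
    unfolding v_def V_def by (rule suminf_exp_weight_le[OF x])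
  have "ennreal ((cmod (laplace g (complex_of_real x + \<i> * of_int n)))\<^sup>2)
      \<le> V * (\<Sum>k. ennreal ((cmod (B n k))\<^sup>2 / v k))" for n
    by (rule norm_sums_power2_le[OF sums v_pos sum_v])
  then have "(\<integral>\<^sup>+n. ennreal ((cmod (laplace g (complex_of_real x + \<i> * of_int n)))\<^sup>2) \<partial>count_space UNIV)
      \<le> (\<integral>\<^sup>+n. V * (\<Sum>k. ennreal ((cmod (B n k))\<^sup>2 / v k)) \<partial>count_space UNIV)"
    by (intro nn_integral_mono)
  also have "\<dots> = V * (\<Sum>k. \<integral>\<^sup>+n. ennreal ((cmod (B n k))\<^sup>2 / v k) \<partial>count_space UNIV)"
    by (simp add: nn_integral_cmult nn_integral_suminf)
  also have "\<dots> \<le> V * (\<Sum>k. ennreal (2 * pi) * (\<integral>\<^sup>+t\<in>I k. ennreal (w t) \<partial>pos_lebesgue))"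
  proof (intro mult_left_mono suminf_le)
    fix k
    have "(\<integral>\<^sup>+n. ennreal ((cmod (B n k))\<^sup>2 / v k) \<partial>count_space UNIV)
        = ennreal (1 / v k) * (\<integral>\<^sup>+n. ennreal ((cmod (B n k))\<^sup>2) \<partial>count_space UNIV)"
      using v_pos[of k] by (subst nn_integral_cmult[symmetric]) (auto simp: ennreal_mult'[symmetric])
    \<comment> \<open>For fixed \<open>k\<close> the numbers \<open>B n k\<close> are the Fourier
      coefficients of \<open>h\<close> on one period.\<close>
    also have "\<dots> \<le> ennreal (1 / v k) * (ennreal (2 * pi) * (\<integral>\<^sup>+t\<in>I k. ennreal ((cmod (h t))\<^sup>2) \<partial>pos_lebesgue))"
      unfolding B_def I_def by (intro mult_left_mono Bessel_interval) auto
    also have "\<dots> = ennreal (2 * pi) * (\<integral>\<^sup>+t. ennreal (1 / v k) * (ennreal ((cmod (h t))\<^sup>2) * indicator (I k) t) \<partial>pos_lebesgue)"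
      by (subst nn_integral_cmult) (auto simp: mult_ac)
    also have "\<dots> \<le> ennreal (2 * pi) * (\<integral>\<^sup>+t\<in>I k. ennreal (w t) \<partial>pos_lebesgue)"
    proof (intro mult_left_mono nn_integral_mono)
      fix t
      \<comment> \<open>On \<open>I k\<close> one has \<open>t > 2 * pi * k \<ge> k\<close>: the
        first inequality controls the exponential, the second gives
        \<open>sqrt (k + 1) \<le> sqrt (1 + t)\<close>.\<close>
      have "(cmod (h t))\<^sup>2 / v k \<le> w t" if "t \<in> I k"
      proof -
        have t: "2 * pi * k < t" using that by (simp add: I_def)
        have "real k \<le> 2 * pi * k" using pi_gt3 by (simp add: mult_le_cancel_right1)
        then have "sqrt (real k + 1) \<le> sqrt (1 + t)" using t by simp
        moreover have "exp (2 * pi * k * x - 2 * x * t) \<le> exp (- (x * t))"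
          using mult_right_mono[OF less_imp_le[OF t], of x] x(1) by (simp add: mult_ac)
        ultimately have "sqrt (real k + 1) * exp (2 * pi * k * x - 2 * x * t) * (cmod (g t))\<^sup>2 \<le> w t"
          unfolding w_def by (intro mult_mono) auto
        moreover have "(cmod (g t) * exp (- (x * t)))\<^sup>2 / v k = sqrt (real k + 1) * exp (2 * pi * k * x - 2 * x * t) * (cmod (g t))\<^sup>2"
          unfolding v_def exp_diff exp_double[of "x * t", unfolded mult.assoc[symmetric]]
          by (simp add: power_mult_distrib powr_minus powr_half_sqrt exp_minus field_simps)
        ultimately show ?thesis by (simp add: h_def norm_mult)
      qed
      then show "ennreal (1 / v k) * (ennreal ((cmod (h t))\<^sup>2) * indicator (I k) t) \<le> ennreal (w t) * indicator (I k) t"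
        using v_pos[of k] by (auto simp: indicator_def ennreal_mult'[symmetric] intro!: ennreal_leI)
    qed auto
    finally show "(\<integral>\<^sup>+n. ennreal ((cmod (B n k))\<^sup>2 / v k) \<partial>count_space UNIV)
      \<le> ennreal (2 * pi) * (\<integral>\<^sup>+t\<in>I k. ennreal (w t) \<partial>pos_lebesgue)" .
  qed auto
  also have "\<dots> = V * (ennreal (2 * pi) * (\<Sum>k. \<integral>\<^sup>+t\<in>I k. ennreal (w t) \<partial>pos_lebesgue))"
    by simp
  also have "(\<Sum>k. \<integral>\<^sup>+t\<in>I k. ennreal (w t) \<partial>pos_lebesgue) = (\<integral>\<^sup>+t\<in>(\<Union>k. I k). ennreal (w t) \<partial>pos_lebesgue)"
  proof (rule nn_integral_disjoint_family[symmetric])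
    have "I j \<inter> I k = {}" if "j < k" for j k
    proof -
      have "2 * pi * (real j + 1) \<le> 2 * pi * k"
        using that by (intro mult_left_mono) auto
      then show ?thesis by (auto simp: I_def algebra_simps)
    qed
    then show "disjoint_family I"
      unfolding disjoint_family_on_def by (metis Int_commute linorder_neqE_nat)
  qed auto
  also have "\<dots> \<le> (\<integral>\<^sup>+t. ennreal (w t) \<partial>pos_lebesgue)"
    by (intro nn_integral_mono) (auto simp: indicator_def)
  finally show ?thesis
    unfolding V_def w_def by (simp add: mult_left_mono)
qed

text \<open>Integrate the bound for fixed \<open>x\<close> over the tooth and exchange the
  integrals. The \<open>x\<close>-integral is at most
  \<open>exp b * Gamma (1/2) * (1 + t) powr (-1/2)\<close>, which cancels
  \<open>sqrt (1 + t)\<close>. One factor \<open>exp b * Gamma (1/2)\<close> comes from the weights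
  and one from this integral, hence the square.\<close>

lemma laplace_comb_L2_le:
  fixes g :: "real \<Rightarrow> complex"
  assumes b: "0 < b" and g [measurable]: "g \<in> borel_measurable pos_lebesgue"
  shows "(\<integral>\<^sup>+y. ennreal ((cmod (laplace g (comb_param y)))\<^sup>2) \<partial>comb_domain b)
    \<le> ennreal (2 * pi * (exp b * Gamma (1/2))\<^sup>2) * (\<integral>\<^sup>+t. ennreal ((cmod (g t))\<^sup>2) \<partial>pos_lebesgue)"
proof (cases "(\<integral>\<^sup>+t. ennreal ((cmod (g t))\<^sup>2) \<partial>pos_lebesgue) < \<infinity>")
  \<comment> \<open>The right side is infinite because the constant is strictly positive.\<close>
  case False
  then have "ennreal c * (\<integral>\<^sup>+t. ennreal ((cmod (g t))\<^sup>2) \<partial>pos_lebesgue) = top" if "0 < c" for c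
    using that by (simp add: less_top[symmetric] ennreal_mult_top)
  moreover have "0 < 2 * pi * (exp b * Gamma (1/2 :: real))\<^sup>2"
    by (intro mult_pos_pos zero_less_power Gamma_real_pos) auto
  ultimately show ?thesis by (simp only: top_greatest)
next
  case True
  define R where "R = restrict_space lborel {0..b}"
  define c where "c = 2 * pi * (exp b * Gamma (1/2 :: real))"
  have c: "0 \<le> c" by (simp add: c_def Gamma_real_nonneg)
  interpret P: pair_sigma_finite "count_space (UNIV :: int set)" R
    unfolding R_def
    by (intro pair_sigma_finite.intro sigma_finite_count_space_int sigma_finite_restrict_lborel)
  interpret Q: pair_sigma_finite R pos_lebesgue
    unfolding R_def
    by (intro pair_sigma_finite.intro sigma_finite_pos_lebesgue sigma_finite_restrict_lborel)
  have ident_R [measurable]: "(\<lambda>x. x) \<in> R \<rightarrow>\<^sub>M borel"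
    unfolding R_def by (rule measurable_restrict_space1) simp
  note [measurable] = borel_measurable_laplace[OF g]
  have "(\<integral>\<^sup>+y. ennreal ((cmod (laplace g (comb_param y)))\<^sup>2) \<partial>comb_domain b)
      = (\<integral>\<^sup>+x. \<integral>\<^sup>+n. ennreal ((cmod (laplace g (complex_of_real x + \<i> * of_int n)))\<^sup>2) \<partial>count_space UNIV \<partial>R)"
    unfolding R_def[symmetric] by (subst P.nn_integral_snd[symmetric]) auto
  also have "\<dots> \<le> (\<integral>\<^sup>+x. \<integral>\<^sup>+t. ennreal (c * (x powr (-1/2) * exp (- (x * t)))) *
      ennreal (sqrt (1 + t) * (cmod (g t))\<^sup>2) \<partial>pos_lebesgue \<partial>R)"
  proof (rule nn_integral_mono_AE)
    \<comment> \<open>The bound at a fixed abscissa needs \<open>0 < x\<close>; the left endpoints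
      are null.\<close>
    have "AE x in R. x \<in> {0..b} \<and> x \<noteq> 0"
      unfolding R_def using AE_lborel_singleton[of 0] by (subst AE_restrict_space_iff) auto
    then show "AE x in R. (\<integral>\<^sup>+n. ennreal ((cmod (laplace g (complex_of_real x + \<i> * of_int n)))\<^sup>2) \<partial>count_space UNIV)
        \<le> (\<integral>\<^sup>+t. ennreal (c * (x powr (-1/2) * exp (- (x * t)))) *
            ennreal (sqrt (1 + t) * (cmod (g t))\<^sup>2) \<partial>pos_lebesgue)"
    proof eventually_elim
      case (elim x)
      have "(\<integral>\<^sup>+n. ennreal ((cmod (laplace g (complex_of_real x + \<i> * of_int n)))\<^sup>2) \<partial>count_space UNIV)
        \<le> ennreal (exp b * (Gamma (1/2) * x powr (-1/2))) * (ennreal (2 * pi) *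
          (\<integral>\<^sup>+t. ennreal (sqrt (1 + t) * exp (- (x * t)) * (cmod (g t))\<^sup>2) \<partial>pos_lebesgue))"
        using elim by (intro laplace_vertical_L2_le[OF _ _ g True]) auto
      also have "\<dots> = ennreal (c * x powr (-1/2)) *
          (\<integral>\<^sup>+t. ennreal (sqrt (1 + t) * exp (- (x * t)) * (cmod (g t))\<^sup>2) \<partial>pos_lebesgue)"
        by (simp add: c_def mult.assoc[symmetric] ennreal_mult'[symmetric] Gamma_real_nonneg) (simp add: mult_ac)
      also have "\<dots> = (\<integral>\<^sup>+t. ennreal (c * x powr (-1/2)) *
          ennreal (sqrt (1 + t) * exp (- (x * t)) * (cmod (g t))\<^sup>2) \<partial>pos_lebesgue)"
        by (rule nn_integral_cmult[symmetric]) measurable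
      also have "\<dots> = (\<integral>\<^sup>+t. ennreal (c * (x powr (-1/2) * exp (- (x * t)))) *
            ennreal (sqrt (1 + t) * (cmod (g t))\<^sup>2) \<partial>pos_lebesgue)"
        using c by (intro nn_integral_cong) (simp add: ennreal_mult[symmetric] mult_ac)
      finally show ?case .
    qed
  qed
  also have "\<dots> = (\<integral>\<^sup>+t. \<integral>\<^sup>+x. ennreal (c * (x powr (-1/2) * exp (- (x * t)))) *
      ennreal (sqrt (1 + t) * (cmod (g t))\<^sup>2) \<partial>R \<partial>pos_lebesgue)"
    by (rule Q.Fubini'[symmetric]) measurable
  also have "\<dots> \<le> (\<integral>\<^sup>+t. ennreal (c * (exp b * Gamma (1/2))) * ennreal ((cmod (g t))\<^sup>2) \<partial>pos_lebesgue)"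
  proof (rule nn_integral_mono)
    fix t assume "t \<in> space pos_lebesgue"
    then have t: "0 < t" by simp
    have "(\<integral>\<^sup>+x. ennreal (c * (x powr (-1/2) * exp (- (x * t)))) \<partial>R)
      = (\<integral>\<^sup>+x\<in>{0..b}. ennreal (c * (x powr (-1/2) * exp (- (x * t)))) \<partial>lborel)"
      unfolding R_def by (rule nn_integral_restrict_space) simp
    \<comment> \<open>Since \<open>x \<le> b\<close>, the factor \<open>exp b * exp (- x)\<close> is
      at least \<open>1\<close>. Inserting it raises the decay rate from \<open>t\<close> to
      \<open>1 + t\<close>, so that the integral stays bounded as \<open>t\<close> tends to
      \<open>0\<close>.\<close>
    also have "\<dots> \<le> (\<integral>\<^sup>+x. ennreal (c * exp b) *
        (ennreal (x powr (-1/2) * exp (- ((1 + t) * x))) * indicator {0<..} x) \<partial>lborel)"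
    proof (rule nn_integral_mono)
      fix x
      have "c * (x powr (-1/2) * exp (- (x * t))) \<le> c * exp b * (x powr (-1/2) * exp (- ((1 + t) * x)))"
        if "x \<le> b"
      proof -
        have "exp (- (x * t)) \<le> exp b * exp (- ((1 + t) * x))"
          using that unfolding exp_add[symmetric] by (simp add: algebra_simps)
        then have "(c * x powr (-1/2)) * exp (- (x * t)) \<le> (c * x powr (-1/2)) * (exp b * exp (- ((1 + t) * x)))"
          using c by (intro mult_left_mono) auto
        then show ?thesis by (simp add: mult_ac)
      qed
      \<comment> \<open>At \<open>x = 0\<close> both sides vanish, the left one because
        \<open>0 powr (-1/2) = 0\<close>.\<close>
      then show "ennreal (c * (x powr (-1/2) * exp (- (x * t)))) * indicator {0..b} x
        \<le> ennreal (c * exp b) * (ennreal (x powr (-1/2) * exp (- ((1 + t) * x))) * indicator {0<..} x)"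
        using c by (cases "x = 0") (auto simp: indicator_def ennreal_mult'[symmetric] intro!: ennreal_leI)
    qed
    also have "\<dots> = ennreal (c * exp b) * (\<integral>\<^sup>+x\<in>{0<..}. ennreal (x powr (-1/2) * exp (- ((1 + t) * x))) \<partial>lborel)"
      supply measurable_ident_pos_lebesgue [measurable del] ident_R [measurable del]
      by (rule nn_integral_cmult) measurable
    also have "\<dots> = ennreal (c * exp b) * ennreal (Gamma (1/2) * (1 + t) powr (-1/2))"
      using t by (subst nn_integral_powr_exp) auto
    also have "\<dots> = ennreal (c * (exp b * Gamma (1/2)) * (1 + t) powr (-1/2))"
      using c by (simp add: ennreal_mult'[symmetric] mult_ac)
    finally have "(\<integral>\<^sup>+x. ennreal (c * (x powr (-1/2) * exp (- (x * t)))) \<partial>R) * ennreal (sqrt (1 + t) * (cmod (g t))\<^sup>2)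
        \<le> ennreal (c * (exp b * Gamma (1/2)) * (1 + t) powr (-1/2)) * ennreal (sqrt (1 + t) * (cmod (g t))\<^sup>2)"
      by (rule mult_right_mono) simp
    also have "\<dots> = ennreal (c * (exp b * Gamma (1/2))) * ennreal ((cmod (g t))\<^sup>2)"
      using t c by (simp add: ennreal_mult'[symmetric] ennreal_mult''[symmetric] powr_minus powr_half_sqrt field_simps)
    finally show "(\<integral>\<^sup>+x. ennreal (c * (x powr (-1/2) * exp (- (x * t)))) * ennreal (sqrt (1 + t) * (cmod (g t))\<^sup>2) \<partial>R)
        \<le> ennreal (c * (exp b * Gamma (1/2))) * ennreal ((cmod (g t))\<^sup>2)"
      by (subst nn_integral_multc) auto
  qed
  also have "\<dots> = ennreal (c * (exp b * Gamma (1/2))) * (\<integral>\<^sup>+t. ennreal ((cmod (g t))\<^sup>2) \<partial>pos_lebesgue)"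
    by (rule nn_integral_cmult) measurable
  also have "c * (exp b * Gamma (1/2)) = 2 * pi * (exp b * Gamma (1/2))\<^sup>2"
    by (simp add: c_def power2_eq_square mult_ac)
  finally show ?thesis .
qed

section \<open>Interpolation\<close>

lemma nn_integral_powr_Icc_0:
  fixes r u :: real
  assumes "0 < r" "0 \<le> u"
  shows "(\<integral>\<^sup>+l\<in>{0..u}. ennreal (l powr (r - 1)) \<partial>lborel) = ennreal (u powr r / r)"
  using has_integral_powr_from_0[of "r - 1" u] assms
  by (intro nn_integral_has_integral_lebesgue') auto

text \<open>Layer-cake formula for \<open>|T f|^q\<close>, with the level sets bounded by
  Chebyshev's inequality and the L^2 bound for the small part of \<open>f\<close>. Integrating over
  the level first gives back \<open>norm (f t) powr p\<close>. As \<open>A\<close> is the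
  \<open>p\<close>-th power of the L^p norm and \<open>q - 1 = q / p\<close>, the bound is
  homogeneous of degree \<open>q\<close> in \<open>f\<close>. The constant blows up as
  \<open>q\<close> tends to \<open>2\<close>, so \<open>p = 2\<close> is excluded.\<close>

lemma Marcinkiewicz_interpolation:
  fixes T :: "('a \<Rightarrow> 'c::{real_normed_vector, second_countable_topology}) \<Rightarrow>
      'b \<Rightarrow> 'd::{real_normed_vector, second_countable_topology}"
    and f :: "'a \<Rightarrow> 'c" and p q A C :: real
  assumes "sigma_finite_measure M" "sigma_finite_measure N"
    and p: "1 < p" "p < 2" and q: "q = p / (p - 1)"
    and T [measurable]: "\<And>g. g \<in> borel_measurable M \<Longrightarrow> T g \<in> borel_measurable N"
    and subadd: "\<And>g h. g \<in> borel_measurable M \<Longrightarrow> h \<in> borel_measurable M \<Longrightarrow>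
      (\<integral>\<^sup>+t. ennreal (norm (g t)) \<partial>M) < \<infinity> \<Longrightarrow> (\<integral>\<^sup>+t. ennreal ((norm (h t))\<^sup>2) \<partial>M) < \<infinity> \<Longrightarrow>
      AE y in N. norm (T (\<lambda>t. g t + h t) y) \<le> norm (T g y) + norm (T h y)"
    and L1: "\<And>g. g \<in> borel_measurable M \<Longrightarrow>
      AE y in N. ennreal (norm (T g y)) \<le> (\<integral>\<^sup>+t. ennreal (norm (g t)) \<partial>M)"
    and L2: "\<And>g. g \<in> borel_measurable M \<Longrightarrow>
      (\<integral>\<^sup>+y. ennreal ((norm (T g y))\<^sup>2) \<partial>N) \<le> ennreal C * (\<integral>\<^sup>+t. ennreal ((norm (g t))\<^sup>2) \<partial>M)"
    and C: "0 \<le> C"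
    and f [measurable]: "f \<in> borel_measurable M"
    and A: "(\<integral>\<^sup>+t. ennreal (norm (f t) powr p) \<partial>M) = ennreal A" "0 \<le> A"
  shows "(\<integral>\<^sup>+y. ennreal (norm (T f y) powr q) \<partial>N)
    \<le> ennreal (4 * C * q * 2 powr (q - 2) / (q - 2) * A powr (q - 1))"
proof (cases "A = 0")
  \<comment> \<open>The cut below divides by \<open>A\<close>, so \<open>A = 0\<close> is separate:
    there \<open>f\<close> vanishes almost everywhere, and the L^2 bound kills
    \<open>T f\<close>.\<close>
  case True
  then have "AE t in M. norm (f t) powr p = 0"
    using A by (simp add: nn_integral_0_iff_AE)
  then have "(\<integral>\<^sup>+t. ennreal ((norm (f t))\<^sup>2) \<partial>M) = 0"
    by (subst nn_integral_0_iff_AE) auto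
  then have "(\<integral>\<^sup>+y. ennreal ((norm (T f y))\<^sup>2) \<partial>N) = 0"
    using L2[OF f] by simp
  then have "AE y in N. norm (T f y) = 0"
    by (simp add: nn_integral_0_iff_AE)
  then have "(\<integral>\<^sup>+y. ennreal (norm (T f y) powr q) \<partial>N) = 0"
    by (subst nn_integral_0_iff_AE) auto
  then show ?thesis by simp
next
  case False
  with A have A_pos: "0 < A" by simp
  have q2: "2 < q" using p by (simp add: q field_simps)
  \<comment> \<open>This identity converts the cut, stated for \<open>norm f powr (p - 1)\<close>,
    into the power \<open>2 - p\<close> separating L^2 from L^p.\<close>
  have pq: "(p - 1) * (q - 2) = 2 - p" using p by (simp add: q field_simps)
  interpret MN: pair_sigma_finite N lborel
    by (intro pair_sigma_finite.intro assms sigma_finite_lborel)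
  interpret LM: pair_sigma_finite lborel M
    by (intro pair_sigma_finite.intro assms sigma_finite_lborel)
  \<comment> \<open>At level \<open>l\<close>, \<open>f\<close> is cut where \<open>l * norm f powr (p - 1) = 2 * A\<close>: this makes the \<open>L\<^sup>1\<close> norm
    of the large part at most \<open>l / 2\<close>, so only the small part can push \<open>T f\<close> above \<open>l\<close>.\<close>
  define F where "F l = (\<integral>\<^sup>+t. ennreal ((norm (f t))\<^sup>2) * indicator {..2 * A} (l * norm (f t) powr (p - 1)) \<partial>M)" for l
  have distr: "(\<integral>\<^sup>+y. indicator {0..norm (T f y)} l \<partial>N) \<le> ennreal (4 * C / l\<^sup>2) * F l" if l: "0 < l" for l :: real
  proof -
    define E where "E t \<longleftrightarrow> l * norm (f t) powr (p - 1) \<le> 2 * A" for t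
    define g where "g t = (if E t then 0 else f t)" for t
    define h where "h t = (if E t then f t else 0)" for t
    have [measurable]: "g \<in> borel_measurable M" "h \<in> borel_measurable M"
      unfolding g_def h_def E_def by measurable
    have g: "(\<integral>\<^sup>+t. ennreal (norm (g t)) \<partial>M) \<le> ennreal (l / 2)"
    proof -
      \<comment> \<open>On the large part \<open>norm (f t) powr (p - 1)\<close> exceeds
        \<open>2 * A / l\<close>.\<close>
      have "norm (g t) \<le> l / (2 * A) * norm (f t) powr p" for t
      proof (cases "E t \<or> f t = 0")
        case False
        then have "2 * A * norm (f t) \<le> l * norm (f t) powr (p - 1) * norm (f t)"
          by (intro mult_right_mono) (auto simp: E_def)
        also have "\<dots> = l * norm (f t) powr p"
          using False by (simp add: powr_diff)
        finally show ?thesis using False A_pos by (simp add: g_def field_simps)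
      qed (use l A_pos in \<open>auto simp: g_def\<close>)
      then have "(\<integral>\<^sup>+t. ennreal (norm (g t)) \<partial>M) \<le> (\<integral>\<^sup>+t. ennreal (l / (2 * A)) * ennreal (norm (f t) powr p) \<partial>M)"
        using l A_pos by (intro nn_integral_mono) (simp add: ennreal_mult'[symmetric] ennreal_leI)
      also have "\<dots> = ennreal (l / (2 * A)) * ennreal A"
        by (simp add: nn_integral_cmult A)
      also have "\<dots> = ennreal (l / 2)"
        using l A_pos by (simp add: ennreal_mult'[symmetric])
      finally show ?thesis .
    qed
    have h_eq: "(\<integral>\<^sup>+t. ennreal ((norm (h t))\<^sup>2) \<partial>M) = F l"
      unfolding F_def h_def E_def by (intro nn_integral_cong) (auto simp: indicator_def)
    have h_fin: "(\<integral>\<^sup>+t. ennreal ((norm (h t))\<^sup>2) \<partial>M) < \<infinity>"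
    proof -
      \<comment> \<open>Raising the cut to the power \<open>q - 2\<close> bounds
        \<open>norm (f t) powr (2 - p)\<close> on the small part; thus \<open>h\<close> is in L^2,
        as \<open>subadd\<close> demands.\<close>
      have "(norm (h t))\<^sup>2 \<le> (2 * A / l) powr (q - 2) * norm (f t) powr p" for t
      proof (cases "E t \<and> f t \<noteq> 0")
        case True
        then have "norm (f t) powr (p - 1) \<le> 2 * A / l"
          using l by (simp add: E_def field_simps)
        then have "(norm (f t) powr (p - 1)) powr (q - 2) \<le> (2 * A / l) powr (q - 2)"
          using q2 by (intro powr_mono2) auto
        then have "norm (f t) powr (2 - p) * norm (f t) powr p \<le> (2 * A / l) powr (q - 2) * norm (f t) powr p"
          by (intro mult_right_mono) (auto simp: powr_powr pq)
        then show ?thesis using True by (simp add: h_def powr_add[symmetric] powr_numeral)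
      qed (auto simp: h_def)
      then have "(\<integral>\<^sup>+t. ennreal ((norm (h t))\<^sup>2) \<partial>M)
          \<le> (\<integral>\<^sup>+t. ennreal ((2 * A / l) powr (q - 2)) * ennreal (norm (f t) powr p) \<partial>M)"
        by (intro nn_integral_mono) (simp add: ennreal_mult'[symmetric] ennreal_leI)
      also have "\<dots> = ennreal ((2 * A / l) powr (q - 2)) * ennreal A"
        by (subst nn_integral_cmult) (auto simp: A)
      also have "\<dots> < \<infinity>"
        by (simp add: ennreal_mult_less_top)
      finally show ?thesis .
    qed
    have "AE y in N. norm (T (\<lambda>t. g t + h t) y) \<le> norm (T g y) + norm (T h y)"
      using g h_fin by (intro subadd) (auto intro: le_less_trans)
    moreover have "(\<lambda>t. g t + h t) = f" by (auto simp: g_def h_def)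
    ultimately have "AE y in N. norm (T f y) \<le> norm (T g y) + norm (T h y)" by simp
    moreover have "AE y in N. norm (T g y) \<le> l / 2"
      using L1[OF \<open>g \<in> borel_measurable M\<close>]
    proof eventually_elim
      case (elim y)
      then have "ennreal (norm (T g y)) \<le> ennreal (l / 2)" using g by (rule order_trans)
      then show ?case using l by simp
    qed
    ultimately have "AE y in N. indicator {0..norm (T f y)} l \<le> ennreal (4 / l\<^sup>2) * ennreal ((norm (T h y))\<^sup>2)"
    proof eventually_elim
      case (elim y)
      show ?case
      proof (cases "l \<le> norm (T f y)")
        case True
        \<comment> \<open>\<open>T g\<close> accounts for at most \<open>l / 2\<close>, so
          \<open>T h\<close> must supply the other half; this is the source of the factor
          \<open>4\<close>.\<close>
        with elim have "l \<le> 2 * norm (T h y)" by linarith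
        then have "l\<^sup>2 \<le> (2 * norm (T h y))\<^sup>2" using l by (intro power_mono) auto
        then have "1 \<le> 4 / l\<^sup>2 * (norm (T h y))\<^sup>2" using l by (simp add: field_simps power_mult_distrib)
        then show ?thesis using ennreal_leI[of 1] by (auto simp: indicator_def ennreal_mult'[symmetric])
      qed (simp add: indicator_def)
    qed
    then have "(\<integral>\<^sup>+y. indicator {0..norm (T f y)} l \<partial>N)
        \<le> (\<integral>\<^sup>+y. ennreal (4 / l\<^sup>2) * ennreal ((norm (T h y))\<^sup>2) \<partial>N)"
      by (rule nn_integral_mono_AE)
    also have "\<dots> = ennreal (4 / l\<^sup>2) * (\<integral>\<^sup>+y. ennreal ((norm (T h y))\<^sup>2) \<partial>N)"
      by (rule nn_integral_cmult) measurable
    also have "\<dots> \<le> ennreal (4 / l\<^sup>2) * (ennreal C * F l)"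
      using L2[of h] by (intro mult_left_mono) (auto simp: h_eq)
    also have "\<dots> = ennreal (4 * C / l\<^sup>2) * F l"
      using C by (simp add: mult.assoc[symmetric] ennreal_mult'[symmetric])
    finally show ?thesis .
  qed
  \<comment> \<open>Layer-cake formula, with the level set encoded as an indicator in
    \<open>l\<close>, ready for Tonelli.\<close>
  have "(\<integral>\<^sup>+y. ennreal (norm (T f y) powr q) \<partial>N)
      = (\<integral>\<^sup>+y. \<integral>\<^sup>+l. ennreal (q * l powr (q - 1)) * indicator {0..norm (T f y)} l \<partial>lborel \<partial>N)"
  proof (intro nn_integral_cong)
    fix y
    have "(\<integral>\<^sup>+l. ennreal (q * l powr (q - 1)) * indicator {0..norm (T f y)} l \<partial>lborel)
      = ennreal q * (\<integral>\<^sup>+l\<in>{0..norm (T f y)}. ennreal (l powr (q - 1)) \<partial>lborel)"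
      using q2 by (subst nn_integral_cmult[symmetric]) (auto simp: ennreal_mult' mult.assoc)
    also have "\<dots> = ennreal (norm (T f y) powr q)"
      using q2 by (simp add: nn_integral_powr_Icc_0 ennreal_mult'[symmetric])
    finally show "ennreal (norm (T f y) powr q) =
      (\<integral>\<^sup>+l. ennreal (q * l powr (q - 1)) * indicator {0..norm (T f y)} l \<partial>lborel)" ..
  qed
  also have "\<dots> = (\<integral>\<^sup>+l. \<integral>\<^sup>+y. ennreal (q * l powr (q - 1)) * indicator {0..norm (T f y)} l \<partial>N \<partial>lborel)"
    unfolding indicator_def by (rule MN.Fubini'[symmetric]) (simp; measurable)
  also have "\<dots> \<le> (\<integral>\<^sup>+l. ennreal (4 * C * q * l powr (q - 3)) * indicator {0..} l * F l \<partial>lborel)"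
  proof (rule nn_integral_mono)
    fix l :: real
    have "(\<integral>\<^sup>+y. ennreal (q * l powr (q - 1)) * indicator {0..norm (T f y)} l \<partial>N)
      = ennreal (q * l powr (q - 1)) * (\<integral>\<^sup>+y. indicator {0..norm (T f y)} l \<partial>N)"
      unfolding indicator_def by (rule nn_integral_cmult) (simp; measurable)
    also have "\<dots> \<le> ennreal (4 * C * q * l powr (q - 3)) * indicator {0..} l * F l"
    proof (cases "0 < l")
      case True
      have "ennreal (q * l powr (q - 1)) * (\<integral>\<^sup>+y. indicator {0..norm (T f y)} l \<partial>N)
        \<le> ennreal (q * l powr (q - 1)) * (ennreal (4 * C / l\<^sup>2) * F l)"
        by (intro mult_left_mono distr True) auto
      also have "\<dots> = ennreal (q * l powr (q - 1) * (4 * C / l\<^sup>2)) * F l"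
        using C True q2 by (simp add: mult.assoc[symmetric] ennreal_mult''[symmetric])
      also have "q * l powr (q - 1) * (4 * C / l\<^sup>2) = 4 * C * q * l powr (q - 3)"
        using True powr_diff[of l "q - 1" 2] by simp
      finally show ?thesis using True by simp
    next
      case False
      \<comment> \<open>At \<open>l = 0\<close> the power vanishes; for \<open>l < 0\<close> the
        indicator does.\<close>
      then show ?thesis by (cases "l = 0") (auto simp: indicator_def)
    qed
    finally show "(\<integral>\<^sup>+y. ennreal (q * l powr (q - 1)) * indicator {0..norm (T f y)} l \<partial>N)
      \<le> ennreal (4 * C * q * l powr (q - 3)) * indicator {0..} l * F l" .
  qed
  also have "\<dots> = (\<integral>\<^sup>+l. \<integral>\<^sup>+t. ennreal (4 * C * q * l powr (q - 3)) * indicator {0..} l *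
      (ennreal ((norm (f t))\<^sup>2) * indicator {..2 * A} (l * norm (f t) powr (p - 1))) \<partial>M \<partial>lborel)"
    unfolding F_def by (intro nn_integral_cong nn_integral_cmult[symmetric]) measurable
  also have "\<dots> = (\<integral>\<^sup>+t. \<integral>\<^sup>+l. ennreal (4 * C * q * l powr (q - 3)) * indicator {0..} l *
      (ennreal ((norm (f t))\<^sup>2) * indicator {..2 * A} (l * norm (f t) powr (p - 1))) \<partial>lborel \<partial>M)"
    by (rule LM.Fubini'[symmetric]) measurable
  also have "\<dots> \<le> (\<integral>\<^sup>+t. ennreal (4 * C * q * (2 * A) powr (q - 2) / (q - 2)) * ennreal (norm (f t) powr p) \<partial>M)"
  proof (rule nn_integral_mono)
    fix t
    define K where "K = 4 * C * q * (norm (f t))\<^sup>2"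
    have K: "0 \<le> K" using C q2 by (simp add: K_def)
    show "(\<integral>\<^sup>+l. ennreal (4 * C * q * l powr (q - 3)) * indicator {0..} l *
        (ennreal ((norm (f t))\<^sup>2) * indicator {..2 * A} (l * norm (f t) powr (p - 1))) \<partial>lborel)
      \<le> ennreal (4 * C * q * (2 * A) powr (q - 2) / (q - 2)) * ennreal (norm (f t) powr p)"
    proof (cases "f t = 0")
      case False
      \<comment> \<open>For fixed \<open>t\<close> the cut holds exactly up to level
        \<open>u\<close>. The power integral over \<open>{0..u}\<close> converges at
        \<open>0\<close> because \<open>q > 2\<close>.\<close>
      define u where "u = 2 * A / norm (f t) powr (p - 1)"
      have "0 \<le> u" using A_pos by (simp add: u_def)
      have "(\<integral>\<^sup>+l. ennreal (4 * C * q * l powr (q - 3)) * indicator {0..} l *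
        (ennreal ((norm (f t))\<^sup>2) * indicator {..2 * A} (l * norm (f t) powr (p - 1))) \<partial>lborel)
        = (\<integral>\<^sup>+l. ennreal K * (ennreal (l powr (q - 2 - 1)) * indicator {0..u} l) \<partial>lborel)"
        using False C q2 by (intro nn_integral_cong)
          (auto simp: indicator_def u_def K_def field_simps ennreal_mult'[symmetric] ennreal_mult''[symmetric])
      also have "\<dots> = ennreal K * ennreal (u powr (q - 2) / (q - 2))"
        using q2 \<open>0 \<le> u\<close> nn_integral_powr_Icc_0[of "q - 2" u] by (subst nn_integral_cmult) auto
      also have "\<dots> = ennreal (K * (u powr (q - 2) / (q - 2)))"
        using K by (simp add: ennreal_mult'[symmetric])
      also have "u powr (q - 2) = (2 * A) powr (q - 2) / norm (f t) powr (2 - p)"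
        using A_pos False by (simp add: u_def powr_divide powr_powr pq)
      also have "K * ((2 * A) powr (q - 2) / norm (f t) powr (2 - p) / (q - 2)) =
          4 * C * q * (2 * A) powr (q - 2) / (q - 2) * ((norm (f t))\<^sup>2 / norm (f t) powr (2 - p))"
        by (simp add: K_def mult_ac)
      also have "(norm (f t))\<^sup>2 / norm (f t) powr (2 - p) = norm (f t) powr p"
        using False powr_diff[of "norm (f t)" 2 "2 - p"] by simp
      finally show ?thesis
        using C q2 A_pos by (simp add: ennreal_mult'[symmetric])
    qed simp
  qed
  also have "\<dots> = ennreal (4 * C * q * (2 * A) powr (q - 2) / (q - 2)) * ennreal A"
    by (subst nn_integral_cmult) (auto simp: A)
  also have "\<dots> = ennreal (4 * C * q * 2 powr (q - 2) / (q - 2) * A powr (q - 1))"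
    using C q2 A_pos powr_add[of A "q - 2" 1] by (simp add: ennreal_mult'[symmetric] powr_mult mult_ac)
  finally show ?thesis .
qed

section \<open>From the endpoint bounds to the theorem\<close>

text \<open>The exponential has modulus at most \<open>1\<close>. Where the integrand is not
  integrable, the Bochner integral is \<open>0\<close> and the bound is trivial.\<close>

lemma norm_laplace_le:
  assumes "0 \<le> Re z"
  shows "ennreal (cmod (laplace f z)) \<le> (\<integral>\<^sup>+t. ennreal (cmod (f t)) \<partial>pos_lebesgue)"
proof (cases "integrable pos_lebesgue (\<lambda>t. f t * exp (- z * complex_of_real t))")
  case True
  have "ennreal (cmod (laplace f z)) \<le> (\<integral>\<^sup>+t. ennreal (cmod (f t * exp (- z * complex_of_real t))) \<partial>pos_lebesgue)"
    unfolding laplace_def by (rule integral_norm_bound_ennreal[OF True])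
  also have "\<dots> \<le> (\<integral>\<^sup>+t. ennreal (cmod (f t)) \<partial>pos_lebesgue)"
    using assms by (intro nn_integral_mono ennreal_leI) (simp add: norm_mult mult_left_le)
  finally show ?thesis .
next
  case False
  then show ?thesis by (simp add: laplace_def not_integrable_integral_eq)
qed

text \<open>Each tooth meets the imaginary axis in one null point. Off these points the Laplace
  integral of an L^2 function converges.\<close>

lemma AE_comb_domain_pos: "AE y in comb_domain b. 0 < snd y"
proof -
  interpret pair_sigma_finite "count_space (UNIV :: int set)" "restrict_space lborel {0..b}"
    by (intro pair_sigma_finite.intro sigma_finite_count_space_int sigma_finite_restrict_lborel)
  have [measurable]: "(\<lambda>x. x) \<in> restrict_space lborel {0..b} \<rightarrow>\<^sub>M borel"
    by (rule measurable_restrict_space1) simp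
  show ?thesis
  proof (rule AE_pair_measure)
    show "{y \<in> space (comb_domain b). 0 < snd y} \<in> sets (comb_domain b)" by measurable
    have "AE x in restrict_space lborel {0..b}. 0 < x"
      using AE_lborel_singleton[of 0] by (subst AE_restrict_space_iff) (auto elim!: eventually_mono)
    then show "AE n in count_space UNIV. AE x in restrict_space lborel {0..b}. 0 < snd (n :: int, x)"
      by simp
  qed
qed

text \<open>For \<open>x > 0\<close> both integrals converge absolutely, so \<open>laplace\<close>
  is truly additive there; with the default value \<open>0\<close> additivity could fail.\<close>

lemma laplace_comb_subadd:
  fixes g h :: "real \<Rightarrow> complex"
  assumes [measurable]: "g \<in> borel_measurable pos_lebesgue" "h \<in> borel_measurable pos_lebesgue"
    and g: "(\<integral>\<^sup>+t. ennreal (cmod (g t)) \<partial>pos_lebesgue) < \<infinity>"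
    and h: "(\<integral>\<^sup>+t. ennreal ((cmod (h t))\<^sup>2) \<partial>pos_lebesgue) < \<infinity>"
  shows "AE y in comb_domain b. cmod (laplace (\<lambda>t. g t + h t) (comb_param y))
    \<le> cmod (laplace g (comb_param y)) + cmod (laplace h (comb_param y))"
  using AE_comb_domain_pos
proof eventually_elim
  case (elim y)
  obtain n x where y: "y = (n, x)" by (cases y)
  have x: "0 < x" using elim y by simp
  have "integrable pos_lebesgue g"
    by (rule integrableI_bounded) (use g in auto)
  then have ig: "integrable pos_lebesgue (\<lambda>t. g t * complex_of_real (exp (- (x * t))) * cis (- (of_int n * t)))"
    by (rule Bochner_Integration.integrable_bound)
      (use x in \<open>auto simp: norm_mult mult_left_le intro!: AE_I2\<close>)
  have ih: "integrable pos_lebesgue (\<lambda>t. h t * complex_of_real (exp (- (x * t))) * cis (- (of_int n * t)))"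
    by (rule Bochner_Integration.integrable_bound[OF integrable_mult_exp[OF _ h x]]) (auto simp: norm_mult)
  have "laplace (\<lambda>t. g t + h t) (comb_param y) = laplace g (comb_param y) + laplace h (comb_param y)"
    unfolding y prod.case laplace_comb distrib_right
    by (rule Bochner_Integration.integral_add[OF ig ih])
  then show ?case by (simp add: norm_triangle_ineq)
qed

text \<open>At \<open>p = 2\<close> the L^2 bound is used directly, since the interpolation constant
  has \<open>q - 2\<close> in its denominator.\<close>

lemma laplace_comb_Lq_le:
  fixes f :: "real \<Rightarrow> complex" and p q b C A :: real
  assumes b: "0 < b" and p: "1 < p" "p \<le> 2" and q: "q = p / (p - 1)"
    and C: "C = 2 * pi * (exp b * Gamma (1/2))\<^sup>2"
    and f [measurable]: "f \<in> borel_measurable pos_lebesgue"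
    and A: "(\<integral>\<^sup>+t. ennreal (cmod (f t) powr p) \<partial>pos_lebesgue) = ennreal A" "0 \<le> A"
  shows "(\<integral>\<^sup>+y. ennreal (cmod (laplace f (comb_param y)) powr q) \<partial>comb_domain b)
    \<le> ennreal ((if p = 2 then C else 4 * C * q * 2 powr (q - 2) / (q - 2)) * A powr (q - 1))"
proof (cases "p = 2")
  case True
  then have q2: "q = 2" using q by simp
  have "ennreal (C * A) = ennreal C * ennreal A"
    using A(2) by (simp add: ennreal_mult'')
  then show ?thesis
    using laplace_comb_L2_le[OF b f] A unfolding C[symmetric] q2 by (simp add: True)
next
  case False
  then have p2: "p < 2" using p by simp
  have "0 \<le> C" by (simp add: C)
  have "(\<integral>\<^sup>+y. ennreal (cmod (laplace f (comb_param y)) powr q) \<partial>comb_domain b)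
    \<le> ennreal (4 * C * q * 2 powr (q - 2) / (q - 2) * A powr (q - 1))"
  proof (rule Marcinkiewicz_interpolation[where T = "\<lambda>g y. laplace g (comb_param y)" and M = pos_lebesgue
        and N = "comb_domain b" and f = f and p = p,
        OF sigma_finite_pos_lebesgue sigma_finite_comb_domain p(1) p2 q _ _ _ _ \<open>0 \<le> C\<close> f A])
    fix g :: "real \<Rightarrow> complex" assume g: "g \<in> borel_measurable pos_lebesgue"
    show "(\<lambda>y. laplace g (comb_param y)) \<in> borel_measurable (comb_domain b)"
      using borel_measurable_laplace[OF g] by measurable
    show "AE y in comb_domain b. ennreal (cmod (laplace g (comb_param y))) \<le> (\<integral>\<^sup>+t. ennreal (cmod (g t)) \<partial>pos_lebesgue)"
      using AE_comb_domain_pos by eventually_elim (auto intro!: norm_laplace_le split: prod.splits)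
    show "(\<integral>\<^sup>+y. ennreal ((cmod (laplace g (comb_param y)))\<^sup>2) \<partial>comb_domain b)
        \<le> ennreal C * (\<integral>\<^sup>+t. ennreal ((cmod (g t))\<^sup>2) \<partial>pos_lebesgue)"
      unfolding C by (rule laplace_comb_L2_le[OF b g])
  qed (rule laplace_comb_subadd)
  then show ?thesis using False by simp
qed

lemma laplace_measurable_comb_arclength:
  assumes "f \<in> borel_measurable pos_lebesgue"
  shows "laplace f \<in> borel_measurable (comb_arclength b)"
  unfolding comb_arclength_def measurable_distr_eq1
  by (rule measurable_restrict_space1[OF borel_measurable_laplace[OF assms]])

lemma nn_integral_comb_arclength_param:
  assumes "0 \<le> b" and "g \<in> borel_measurable borel"
  shows "(\<integral>\<^sup>+z. g z \<partial>comb_arclength b) = (\<integral>\<^sup>+y. g (comb_param y) \<partial>comb_domain b)"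
  unfolding comb_arclength_def
  by (rule nn_integral_distr[OF measurable_comb_param[OF assms(1)]])
    (simp add: measurable_restrict_space1 assms(2))

lemma conjugate_exponent_1:
  assumes "1 / ennreal 1 + 1 / (p' :: ennreal) = 1"
  shows "p' = top"
proof -
  have "1 + 1 / p' = 1 + 0" using assms by simp
  then have "1 / p' = 0" unfolding ennreal_add_left_cancel by simp
  then show ?thesis by (simp add: ennreal_divide_eq_0_iff)
qed

lemma conjugate_exponent:
  fixes p :: real
  assumes p: "1 < p" and eq: "1 / ennreal p + 1 / p' = 1"
  shows "p' = ennreal (p / (p - 1))"
proof (cases p')
  case top
  \<comment> \<open>An infinite \<open>p'\<close> would force \<open>1 / p = 1\<close>, against
    \<open>1 < p\<close>.\<close>
  have "ennreal (1 / p) = 1" using eq p by (simp add: top divide_ennreal[symmetric])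
  then show ?thesis using p by simp
next
  case (real r)
  \<comment> \<open>In \<open>ennreal\<close>, \<open>1 / 0\<close> is \<open>top\<close>.\<close>
  have "r \<noteq> 0" using eq real by auto
  then have r: "0 < r" using real by simp
  have "ennreal (1 / p + 1 / r) = 1 / ennreal p + 1 / p'"
    using p r real by (simp add: divide_ennreal[symmetric])
  also have "\<dots> = ennreal 1" using eq by simp
  finally have "1 / p + 1 / r = 1" using p r by (subst (asm) ennreal_inj) auto
  then have "r = p / (p - 1)" using p r by (simp add: field_simps)
  then show ?thesis using real by simp
qed

theorem theorem12:
  fixes b p :: real and p' :: ennreal
  assumes "0 < b" and "1 \<le> p" and "p \<le> 2" and "1 / ennreal p + 1 / p' = 1"
  shows "\<exists>K::real. \<forall>f :: real \<Rightarrow> complex. f \<in> Lp_space (ennreal p) (lebesgue_on {0<..}) \<longrightarrow>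
    laplace f \<in> Lp_space p' (comb_arclength b) \<and>
    Lp_norm p' (comb_arclength b) (laplace f) \<le>
      ennreal K * Lp_norm (ennreal p) (lebesgue_on {0<..}) f"
proof -
  \<comment> \<open>The norm inequality comes first; membership of \<open>laplace f\<close> in
    \<open>Lp_space p'\<close> then follows because its right side is finite.\<close>
  have "\<exists>K. \<forall>f :: real \<Rightarrow> complex. f \<in> Lp_space (ennreal p) pos_lebesgue \<longrightarrow>
    Lp_norm p' (comb_arclength b) (laplace f) \<le> ennreal K * Lp_norm (ennreal p) pos_lebesgue f"
  proof (cases "p = 1")
    case True
    then have p': "p' = top" using assms(4) conjugate_exponent_1 by simp
    show ?thesis
    proof (intro exI[of _ 1] allI impI)
      fix f :: "real \<Rightarrow> complex" assume f: "f \<in> Lp_space (ennreal p) pos_lebesgue"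
      then have [measurable]: "f \<in> borel_measurable pos_lebesgue" by (simp add: Lp_space_def)
      note [measurable] = laplace_measurable_comb_arclength[OF this]
      have "Lp_norm p' (comb_arclength b) (laplace f) \<le> (\<integral>\<^sup>+t. ennreal (cmod (f t)) \<partial>pos_lebesgue)"
        unfolding Lp_norm_def p' if_P[OF refl]
      proof (rule esssup_I)
        \<comment> \<open>The bound holds at every point of the comb, left endpoints
          included.\<close>
        have "0 \<le> Re z" if "z \<in> space (comb_arclength b)" for z
          using that assms(1) by (auto simp: comb_arclength_def space_restrict_space comb_eq)
        then show "AE z in comb_arclength b. ennreal (cmod (laplace f z)) \<le> (\<integral>\<^sup>+t. ennreal (cmod (f t)) \<partial>pos_lebesgue)"
          by (intro AE_I2 norm_laplace_le)
      qed measurable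
      also have "\<dots> = Lp_norm (ennreal p) pos_lebesgue f"
        by (simp add: Lp_norm_def True epowr_def less_top)
      finally show "Lp_norm p' (comb_arclength b) (laplace f) \<le> ennreal 1 * Lp_norm (ennreal p) pos_lebesgue f"
        by simp
    qed
  next
    case False
    then have p: "1 < p" using assms(2) by simp
    define q where "q = p / (p - 1)"
    have p': "p' = ennreal q" unfolding q_def by (rule conjugate_exponent[OF p assms(4)])
    have q: "0 < q" "(q - 1) * (1 / q) = 1 / p" using p by (simp_all add: q_def field_simps)
    define C where "C = 2 * pi * (exp b * Gamma (1/2 :: real))\<^sup>2"
    define K where "K = (if p = 2 then C else 4 * C * q * 2 powr (q - 2) / (q - 2))"
    have "2 \<le> q" using p assms(3) by (simp add: q_def field_simps)
    moreover have "0 \<le> C" by (simp add: C_def)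
    ultimately have K: "0 \<le> K" by (simp add: K_def)
    show ?thesis
    \<comment> \<open>The bound on the integral is \<open>K * A powr (q - 1)\<close>. Its
      \<open>q\<close>-th root gives this witness times \<open>A powr (1 / p)\<close>, since
      \<open>(q - 1) / q = 1 / p\<close>.\<close>
    proof (intro exI[of _ "K powr (1 / q)"] allI impI)
      fix f :: "real \<Rightarrow> complex" assume f: "f \<in> Lp_space (ennreal p) pos_lebesgue"
      then have f_meas: "f \<in> borel_measurable pos_lebesgue" by (simp add: Lp_space_def)
      note [measurable] = borel_measurable_laplace[OF f_meas]
      have "(\<integral>\<^sup>+t. ennreal (cmod (f t) powr p) \<partial>pos_lebesgue) \<noteq> top"
        using f p by (auto simp: Lp_space_def Lp_norm_def epowr_def)
      then obtain A where A: "(\<integral>\<^sup>+t. ennreal (cmod (f t) powr p) \<partial>pos_lebesgue) = ennreal A" "0 \<le> A"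
        by (cases "\<integral>\<^sup>+t. ennreal (cmod (f t) powr p) \<partial>pos_lebesgue") auto
      define B where "B = (\<integral>\<^sup>+z. ennreal (cmod (laplace f z) powr q) \<partial>comb_arclength b)"
      have B: "B \<le> ennreal (K * A powr (q - 1))"
        using laplace_comb_Lq_le[OF assms(1) p assms(3) q_def C_def f_meas A] assms(1)
        unfolding B_def K_def by (subst nn_integral_comb_arclength_param) auto
      have "Lp_norm p' (comb_arclength b) (laplace f) = epowr B (1 / q)"
        using q by (simp add: Lp_norm_def p' B_def)
      also have "\<dots> = ennreal (enn2real B powr (1 / q))"
        using B by (auto simp: epowr_def top_unique)
      also have "\<dots> \<le> ennreal ((K * A powr (q - 1)) powr (1 / q))"
        using B q K by (intro ennreal_leI powr_mono2 enn2real_leI) auto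
      also have "\<dots> = ennreal (K powr (1 / q)) * ennreal (A powr (1 / p))"
        using K by (simp only: powr_mult powr_powr q ennreal_mult powr_ge_zero)
      also have "ennreal (A powr (1 / p)) = Lp_norm (ennreal p) pos_lebesgue f"
        using p A by (simp add: Lp_norm_def epowr_def)
      finally show "Lp_norm p' (comb_arclength b) (laplace f) \<le>
        ennreal (K powr (1 / q)) * Lp_norm (ennreal p) pos_lebesgue f" .
    qed
  qed
  then obtain K where K: "\<And>f :: real \<Rightarrow> complex. f \<in> Lp_space (ennreal p) pos_lebesgue \<Longrightarrow>
    Lp_norm p' (comb_arclength b) (laplace f) \<le> ennreal K * Lp_norm (ennreal p) pos_lebesgue f"
    by blast
  show ?thesis
  proof (intro exI[of _ K] allI impI conjI)
    fix f :: "real \<Rightarrow> complex" assume f: "f \<in> Lp_space (ennreal p) pos_lebesgue"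
    show "Lp_norm p' (comb_arclength b) (laplace f) \<le> ennreal K * Lp_norm (ennreal p) pos_lebesgue f"
      by (rule K[OF f])
    also have "\<dots> < top"
      using f by (simp add: Lp_space_def ennreal_mult_less_top)
    finally show "laplace f \<in> Lp_space p' (comb_arclength b)"
      using f by (simp add: Lp_space_def laplace_measurable_comb_arclength)
  qed
qed

end
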